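(* There exists an absolute constant $C > 0$ such that the following holds for all integers $1 \le k \le n$ and every real $A$. Assume that a convex set $K$ in $\mathbb{R}^n$ has volume ratio $A$ with respect to the unit Euclidean ball. Assume that a convex symmetric set $L$ in $\mathbb{R}^n$ has a section of dimension $k$ whose diameter is bounded by $1$. Then for a random orthogonal operator $U \in \mathcal{O}(n)$, the set $K \cap UL$ has diameter at most $(2A)^{Cn/k}$ with probability at least $1 - e^{-n}$.
   Context: $D$ denotes the unit Euclidean ball in $\mathbb{R}^n$ and $|\cdot|$ denotes $n$-dimensional volume. A convex set $K$ in $\mathbb{R}^n$ has volume ratio $A$ with respect to $D$ if $D \subseteq K$ and $(|K|/|D|)^{1/n} = A$. A set $L$ is symmetric if $L = -L$. A section of $L$ of dimension $k$ is a set $L \cap E$, where $E$ is a $k$-dimensional linear subspace of $\mathbb{R}^n$. Diameters are Euclidean. A random $U \in \mathcal{O}(n)$ is distributed according to the normalized Haar measure on the orthogonal group. "Absolute constant" means a number independent of $n, k, A, K, L$. *)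

theory Defs
  imports "HOL-Probability.Probability"
begin

text \<open>
  The constant in the theorem must not depend on the dimension, so the dimension is quantified
  inside the formula and cannot be a type. We therefore realise all spaces \<open>\<real>\<^sup>n\<close> at once, as the
  subspaces \<open>Rn n\<close> of the inner product space \<open>finseq\<close> of finitely supported real sequences
  (\<open>x\<close> belongs to \<open>Rn n\<close> iff its coordinates with index \<open>\<ge> n\<close> vanish). Then \<open>convex\<close>, \<open>subspace\<close>,
  \<open>dim\<close>, \<open>norm\<close>, \<open>diameter\<close> and \<open>orthogonal_transformation\<close> are those of the library.
\<close>

typedef finseq = "{x :: nat \<Rightarrow> real. finite {i. x i \<noteq> 0}}"
  morphisms coord Abs_finseq
  by (rule exI[of _ "\<lambda>_. 0"]) simp

setup_lifting type_definition_finseq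

lemma finite_coord [simp]: "finite {i. coord x i \<noteq> 0}"
  using coord[of x] by simp

lemma finseq_eqI: "(\<And>i. coord x i = coord y i) \<Longrightarrow> x = y"
  by (simp add: coord_inject[symmetric] fun_eq_iff)

instantiation finseq :: real_vector
begin

lift_definition zero_finseq :: finseq is "\<lambda>_. 0" by simp

lift_definition plus_finseq :: "finseq \<Rightarrow> finseq \<Rightarrow> finseq" is "\<lambda>x y i. x i + y i"
  subgoal for x y by (rule finite_subset[of _ "{i. x i \<noteq> 0} \<union> {i. y i \<noteq> 0}"]) auto
  done

lift_definition uminus_finseq :: "finseq \<Rightarrow> finseq" is "\<lambda>x i. - x i" by simp

lift_definition minus_finseq :: "finseq \<Rightarrow> finseq \<Rightarrow> finseq" is "\<lambda>x y i. x i - y i"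
  subgoal for x y by (rule finite_subset[of _ "{i. x i \<noteq> 0} \<union> {i. y i \<noteq> 0}"]) auto
  done

lift_definition scaleR_finseq :: "real \<Rightarrow> finseq \<Rightarrow> finseq" is "\<lambda>c x i. c * x i"
  subgoal for c x by (rule finite_subset[of _ "{i. x i \<noteq> 0}"]) auto
  done

instance
  by standard (transfer; simp add: fun_eq_iff algebra_simps)+

end

lemma coord_simps [simp]:
  "coord 0 i = 0" "coord (x + y) i = coord x i + coord y i"
  "coord (x - y) i = coord x i - coord y i" "coord (- x) i = - coord x i"
  "coord (c *\<^sub>R x) i = c * coord x i"
  by (transfer; simp)+

instantiation finseq :: real_inner
begin

definition inner_finseq :: "finseq \<Rightarrow> finseq \<Rightarrow> real"
  where "inner_finseq x y = (\<Sum>i | coord x i \<noteq> 0. coord x i * coord y i)"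

definition norm_finseq :: "finseq \<Rightarrow> real"
  where "norm_finseq x = sqrt (inner x x)"

definition dist_finseq :: "finseq \<Rightarrow> finseq \<Rightarrow> real"
  where "dist_finseq x y = norm (x - y)"

definition sgn_finseq :: "finseq \<Rightarrow> finseq"
  where "sgn_finseq x = x /\<^sub>R norm x"

definition uniformity_finseq :: "(finseq \<times> finseq) filter"
  where "uniformity_finseq = (INF e\<in>{0<..}. principal {(x, y). dist x y < e})"

definition open_finseq :: "finseq set \<Rightarrow> bool"
  where "open_finseq S \<longleftrightarrow> (\<forall>x\<in>S. \<forall>\<^sub>F (x', y) in uniformity. x' = x \<longrightarrow> y \<in> S)"

lemma inner_finseq_superset:
  assumes "finite A" "{i. coord x i \<noteq> 0} \<subseteq> A"
  shows "inner x y = (\<Sum>i\<in>A. coord x i * coord y i)"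
  unfolding inner_finseq_def using assms by (intro sum.mono_neutral_left) auto

instance
proof
  fix x y z :: finseq and r :: real and S :: "finseq set"
  let ?A = "{i. coord x i \<noteq> 0} \<union> {i. coord y i \<noteq> 0} \<union> {i. coord z i \<noteq> 0}"
  have A: "finite ?A" by simp
  have x: "inner x w = (\<Sum>i\<in>?A. coord x i * coord w i)" for w
    by (rule inner_finseq_superset[OF A]) auto
  have y: "inner y w = (\<Sum>i\<in>?A. coord y i * coord w i)" for w
    by (rule inner_finseq_superset[OF A]) auto
  show "inner x y = inner y x"
    by (simp add: x y mult.commute)
  have "inner (x + y) z = (\<Sum>i\<in>?A. coord (x + y) i * coord z i)"
    by (rule inner_finseq_superset[OF A]) auto
  then show "inner (x + y) z = inner x z + inner y z"
    by (simp add: x y algebra_simps sum.distrib)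
  have "inner (r *\<^sub>R x) y = (\<Sum>i\<in>?A. coord (r *\<^sub>R x) i * coord y i)"
    by (rule inner_finseq_superset[OF A]) auto
  then show "inner (r *\<^sub>R x) y = r * inner x y"
    by (simp add: x sum_distrib_left mult.assoc)
  show "0 \<le> inner x x"
    by (simp add: inner_finseq_def sum_nonneg)
  have "inner x x = 0 \<longleftrightarrow> (\<forall>i\<in>{i. coord x i \<noteq> 0}. coord x i * coord x i = 0)"
    unfolding inner_finseq_def by (rule sum_nonneg_eq_0_iff) auto
  then show "inner x x = 0 \<longleftrightarrow> x = 0"
    by (auto intro: finseq_eqI)
qed (simp_all add: norm_finseq_def dist_finseq_def sgn_finseq_def uniformity_finseq_def
      open_finseq_def)

end

definition Rn :: "nat \<Rightarrow> finseq set"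
  where "Rn n = {x. \<forall>i\<ge>n. coord x i = 0}"

lift_definition unit_seq :: "nat \<Rightarrow> finseq" is "\<lambda>i j. if j = i then 1 else 0"
  by simp

lift_definition finseq_of :: "nat \<Rightarrow> (nat \<Rightarrow> real) \<Rightarrow> finseq" is "\<lambda>n f i. if i < n then f i else 0"
  subgoal for n f by (rule finite_subset[of _ "{..<n}"]) auto
  done

text \<open>Completed, since a convex set is Lebesgue measurable but in general not Borel measurable.\<close>

definition lebesgue_Rn :: "nat \<Rightarrow> finseq measure"
  where "lebesgue_Rn n = completion (embed_measure (Pi\<^sub>M {..<n} (\<lambda>_. lborel)) (finseq_of n))"

lemma coord_unit_seq: "coord (unit_seq i) j = (if j = i then 1 else 0)"
  by transfer simp

lemma coord_finseq_of: "coord (finseq_of n f) i = (if i < n then f i else 0)"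
  by transfer simp

lemma inner_Rn: "x \<in> Rn n \<Longrightarrow> inner x y = (\<Sum>i<n. coord x i * coord y i)"
  by (rule inner_finseq_superset) (auto simp: Rn_def intro: leI)

lemma inner_unit_seq: "inner (unit_seq i) x = coord x i"
  by (subst inner_finseq_superset[of "{i}"]) (auto simp: coord_unit_seq)

lemma subspace_Rn: "subspace (Rn n)"
  by (auto simp: subspace_def Rn_def)

lemma coord_sum: "coord (sum f A) i = (\<Sum>a\<in>A. coord (f a) i)"
  by (induction A rule: infinite_finite_induct) auto

lemma Rn_eq_sum: "x \<in> Rn n \<Longrightarrow> x = (\<Sum>i<n. coord x i *\<^sub>R unit_seq i)"
  by (rule finseq_eqI) (auto simp: coord_sum coord_unit_seq Rn_def if_distrib cong: if_cong)

lemma dim_Rn: "dim (Rn n) = n"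
proof -
  have inj: "inj unit_seq"
    by (rule injI) (metis coord_unit_seq zero_neq_one)
  show ?thesis
  proof (rule dim_unique)
    show "unit_seq ` {..<n} \<subseteq> Rn n"
      by (auto simp: Rn_def coord_unit_seq)
    show "Rn n \<subseteq> span (unit_seq ` {..<n})"
    proof
      fix x assume "x \<in> Rn n"
      then have "x = (\<Sum>i<n. coord x i *\<^sub>R unit_seq i)" by (rule Rn_eq_sum)
      also have "\<dots> \<in> span (unit_seq ` {..<n})"
        by (intro span_sum span_scale span_base) auto
      finally show "x \<in> span (unit_seq ` {..<n})" .
    qed
    have "pairwise orthogonal (unit_seq ` {..<n})"
      by (auto simp: pairwise_def orthogonal_def inner_unit_seq coord_unit_seq)
    moreover have "unit_seq i \<noteq> 0" for i
      by (metis coord_simps(1) coord_unit_seq zero_neq_one)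
    ultimately show "independent (unit_seq ` {..<n})"
      by (intro pairwise_orthogonal_independent) auto
    show "card (unit_seq ` {..<n}) = n"
      using inj by (simp add: card_image inj_on_subset)
  qed
qed

lemma inj_on_finseq_of: "inj_on (finseq_of n) (PiE {..<n} (\<lambda>_. UNIV))"
proof (rule inj_onI)
  fix f g assume f: "f \<in> PiE {..<n} (\<lambda>_. UNIV)" and g: "g \<in> PiE {..<n} (\<lambda>_. UNIV)"
    and eq: "finseq_of n f = finseq_of n g"
  show "f = g"
  proof (rule PiE_ext[OF f g])
    fix i assume "i \<in> {..<n}"
    then show "f i = g i"
      using arg_cong[OF eq, of "\<lambda>x. coord x i"] by (simp add: coord_finseq_of)
  qed
qed

lemma space_lebesgue_Rn: "space (lebesgue_Rn n) = Rn n"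
proof -
  let ?P = "PiE {..<n} (\<lambda>_. UNIV :: real set)"
  have "finseq_of n ` ?P = Rn n"
  proof
    show "finseq_of n ` ?P \<subseteq> Rn n"
    proof (rule image_subsetI)
      fix f show "finseq_of n f \<in> Rn n" by (simp add: Rn_def coord_finseq_of)
    qed
    show "Rn n \<subseteq> finseq_of n ` ?P"
    proof
      fix x assume "x \<in> Rn n"
      then have "x = finseq_of n (restrict (coord x) {..<n})"
        by (intro finseq_eqI) (simp add: coord_finseq_of Rn_def)
      then show "x \<in> finseq_of n ` ?P"
        by (rule image_eqI[where f = "finseq_of n"]) simp
    qed
  qed
  then show ?thesis
    unfolding lebesgue_Rn_def space_completion space_embed_measure space_PiM space_lborel space_borel .
qed

definition unit_ball :: "nat \<Rightarrow> finseq set"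
  where "unit_ball n = {x \<in> Rn n. norm x \<le> 1}"

text \<open>
  The finiteness condition is implicit in the ratio being a real number; it has to be explicit
  because \<open>measure\<close> sends sets of infinite volume to \<open>0\<close>.
\<close>

definition has_volume_ratio :: "nat \<Rightarrow> finseq set \<Rightarrow> real \<Rightarrow> bool"
  where "has_volume_ratio n K A \<longleftrightarrow>
    unit_ball n \<subseteq> K \<and> emeasure (lebesgue_Rn n) K < \<infinity> \<and>
    root n (measure (lebesgue_Rn n) K / measure (lebesgue_Rn n) (unit_ball n)) = A"

text \<open>The first conjunct is needed because \<open>diameter\<close> is unspecified on unbounded sets.\<close>

definition diameter_le :: "finseq set \<Rightarrow> real \<Rightarrow> bool"
  where "diameter_le S r \<longleftrightarrow> bounded S \<and> diameter S \<le> r"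

text \<open>
  An orthogonal operator of \<open>\<real>\<^sup>n\<close> is identified with its extension to \<open>finseq\<close> that fixes the
  unit sequences with index \<open>\<ge> n\<close>; the group operation is composition of functions.
\<close>

definition orth_group :: "nat \<Rightarrow> (finseq \<Rightarrow> finseq) set"
  where "orth_group n = {U. orthogonal_transformation U \<and> (\<forall>i\<ge>n. U (unit_seq i) = unit_seq i)}"

lemma orth_group_Rn:
  assumes "U \<in> orth_group n"
  shows "U ` Rn n = Rn n"
proof -
  have lin: "linear U" and inner_U: "inner (U x) (U y) = inner x y" for x y
    using assms by (auto simp: orth_group_def orthogonal_transformation_def)
  have "coord (U x) i = coord x i" if "i \<ge> n" for x i
    using assms that inner_U[of "unit_seq i" x] by (simp add: orth_group_def inner_unit_seq)
  then have sub: "U ` Rn n \<subseteq> Rn n"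
    by (auto simp: Rn_def)
  have inj: "inj U"
  proof (rule injI)
    fix x y assume "U x = U y"
    then have "U (x - y) = 0" by (simp add: linear_diff[OF lin])
    then have "inner (x - y) (x - y) = 0"
      using inner_U[of "x - y" "x - y"] by simp
    then show "x = y" by simp
  qed
  let ?B = "U ` unit_seq ` {..<n}"
  have inj_unit: "inj unit_seq"
    by (rule injI) (metis coord_unit_seq zero_neq_one)
  have card_B: "card ?B = n"
    by (simp add: card_image inj_on_subset[OF inj] inj_on_subset[OF inj_unit])
  have B: "?B \<subseteq> Rn n"
    using sub by (force simp: Rn_def coord_unit_seq)
  have "pairwise orthogonal ?B"
    by (auto simp: pairwise_def orthogonal_def inner_U inner_unit_seq coord_unit_seq)
  moreover have "0 \<notin> ?B"
  proof
    assume "0 \<in> ?B"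
    then obtain i where "U (unit_seq i) = 0" by auto
    then show False
      using inner_U[of "unit_seq i" "unit_seq i"] by (simp add: inner_unit_seq coord_unit_seq)
  qed
  ultimately have indep: "independent ?B"
    by (intro pairwise_orthogonal_independent)
  have "Rn n \<subseteq> span ?B"
  proof
    fix y assume y: "y \<in> Rn n"
    show "y \<in> span ?B"
    proof (rule ccontr)
      assume ny: "y \<notin> span ?B"
      then have ind: "independent (insert y ?B)" and "y \<notin> ?B"
        using indep by (auto simp: independent_insert intro: span_base)
      have "Rn n \<subseteq> span (unit_seq ` {..<n})"
      proof
        fix x assume "x \<in> Rn n"
        then have "x = (\<Sum>i<n. coord x i *\<^sub>R unit_seq i)" by (rule Rn_eq_sum)
        also have "\<dots> \<in> span (unit_seq ` {..<n})"
          by (intro span_sum span_scale span_base) auto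
        finally show "x \<in> span (unit_seq ` {..<n})" .
      qed
      then have "card (insert y ?B) \<le> card (unit_seq ` {..<n})"
        using independent_span_bound[OF _ ind, of "unit_seq ` {..<n}"] y B by auto
      also have "\<dots> \<le> n"
        using card_image_le[of "{..<n}" unit_seq] by simp
      finally show False
        using card_B \<open>y \<notin> ?B\<close> by simp
    qed
  qed
  also have "span ?B \<subseteq> U ` Rn n"
    using linear_subspace_image[OF lin subspace_Rn]
    by (intro span_minimal) (auto simp: Rn_def coord_unit_seq)
  finally show ?thesis using sub by auto
qed

definition matrix_entries :: "nat \<Rightarrow> (finseq \<Rightarrow> finseq) \<Rightarrow> nat \<times> nat \<Rightarrow> real"
  where "matrix_entries n U =
    (\<lambda>(i, j)\<in>{..<n} \<times> {..<n}. inner (unit_seq i) (U (unit_seq j)))"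

text \<open>The Borel sigma-algebra of the orthogonal group as a subspace of the \<open>n \<times> n\<close> matrices.\<close>

definition borel_orth :: "nat \<Rightarrow> (finseq \<Rightarrow> finseq) measure"
  where "borel_orth n = vimage_algebra (orth_group n) (matrix_entries n)
    (Pi\<^sub>M ({..<n} \<times> {..<n}) (\<lambda>_. borel))"

text \<open>
  The normalized Haar measure is the unique measure with this property (uniqueness and existence
  are not needed to state that a result holds for it).
\<close>

definition normalized_haar :: "nat \<Rightarrow> (finseq \<Rightarrow> finseq) measure \<Rightarrow> bool"
  where "normalized_haar n \<mu> \<longleftrightarrow>
    prob_space \<mu> \<and> sets \<mu> = sets (borel_orth n) \<and>
    (\<forall>V\<in>orth_group n. distr \<mu> \<mu> (\<lambda>U. V \<circ> U) = \<mu>)"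

end

theory Submission
  imports Defs
begin

text \<open>
  Write \<open>D\<close> for the unit ball and let \<open>R\<close> be half of the asserted diameter. The two bodies play very
  different roles.

  The body \<open>K\<close> enters through a count only: \<open>K\<close> contains at most \<open>(2 A)\<^sup>n\<close> points that are pairwise more than \<open>2\<close>
  apart (\<open>volume_ratio_packing\<close>). If \<open>K \<inter> U L\<close> has diameter greater than \<open>2 R\<close>, then it meets the sphere of radius
  \<open>R\<close>, and so \<open>U L\<close> comes within distance \<open>3\<close> of one of at most \<open>(2 A)\<^sup>n\<close> fixed points of norm \<open>R\<close>. It remains to see that
  for a single point the probability of this is at most \<open>720\<^sup>n\<close> divided by \<open>R\<close> to the power \<open>k/2\<close>
  (\<open>near_event_probability\<close>). For \<open>R \<ge> (2 A) powr (26 n/k)\<close> the union bound then gives \<open>exp (- n)\<close>; all factors of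
  the form \<open>c\<^sup>n\<close> are harmless.

  The Haar measure turns the probability into another count. The probability that \<open>U L\<close> is close to \<open>x\<close> depends only
  on the norm of \<open>x\<close> and decreases with it. So it can be averaged over a separated set of about \<open>R\<^sup>n\<close> points in \<open>R D\<close>, and the
  question becomes how many separated points \<open>L \<inter> R D\<close> can contain.

  The core is the answer \<open>(10 R)\<close> to the power \<open>n - k/2\<close> (\<open>separated_in_fat_body\<close>). A bound with exponent \<open>n - k\<close>
  would follow if the bounded section \<open>L \<inter> E\<close> remained bounded for the neighbourhood \<open>L + D\<close>, but it need not, as
  \<open>E\<close> can be almost tangent to \<open>L\<close>. However, two bounds hold. Counting points of \<open>L \<inter> R D\<close> along
  the fibres of the projection along \<open>E\<close> gives \<open>(10 R)\<^sup>n\<^sup>-\<^sup>k\<close> times the number \<open>m\<close> of separated points in a section of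
  the neighbourhood. A packing argument in the intersection of \<open>D\<close> with \<open>2 L + 3 R D\<^sub>E\<close> shows that \<open>m\<close> times the number of
  separated points of \<open>L \<inter> R D\<close> is at most \<open>(10 R)\<^sup>n\<close>: a section that is large because of tangency forces \<open>L\<close> itself
  to be small. The product of the two bounds eliminates \<open>m\<close>.
\<close>

section \<open>Coordinates, density and interior in \<open>\<real>\<^sup>n\<close>\<close>

lemma Rn_closed [intro]:
  "x \<in> Rn n \<Longrightarrow> y \<in> Rn n \<Longrightarrow> x + y \<in> Rn n"
  "x \<in> Rn n \<Longrightarrow> y \<in> Rn n \<Longrightarrow> x - y \<in> Rn n"
  "x \<in> Rn n \<Longrightarrow> - x \<in> Rn n"
  "x \<in> Rn n \<Longrightarrow> c *\<^sub>R x \<in> Rn n"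
  "0 \<in> Rn n"
  by (auto simp: Rn_def)

lemma finseq_of_in_Rn [simp]: "finseq_of n f \<in> Rn n"
  by (simp add: Rn_def coord_finseq_of)

lemma norm_Rn: "x \<in> Rn n \<Longrightarrow> norm x = sqrt (\<Sum>i<n. (coord x i)\<^sup>2)"
  by (simp add: norm_eq_sqrt_inner inner_Rn power2_eq_square)

lemma abs_coord_le_norm: "\<bar>coord x i\<bar> \<le> norm x"
proof -
  have "norm (unit_seq i) = 1"
    by (simp add: norm_eq_sqrt_inner inner_unit_seq coord_unit_seq)
  then show ?thesis
    using Cauchy_Schwarz_ineq2[of "unit_seq i" x] by (simp add: inner_unit_seq)
qed

lemma norm_le_coord_bound:
  assumes x: "x \<in> Rn n" and le: "\<And>i. i < n \<Longrightarrow> \<bar>coord x i\<bar> \<le> b"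
  shows "norm x \<le> real n * b"
proof -
  have "norm x = L2_set (coord x) {..<n}"
    by (simp add: norm_Rn[OF x] L2_set_def)
  also have "\<dots> \<le> (\<Sum>i<n. \<bar>coord x i\<bar>)"
    by (rule L2_set_le_sum_abs)
  also have "\<dots> \<le> real n * b"
    using sum_bounded_above[of "{..<n}" "\<lambda>i. \<bar>coord x i\<bar>" b] le by simp
  finally show ?thesis .
qed

text \<open>
  Countable dense subsets turn conditions quantified over an arbitrary subset of \<open>\<real>\<^sup>n\<close> into countable
  unions of conditions on balls.
\<close>

lemma countable_dense_subset:
  assumes S: "S \<subseteq> Rn n"
  obtains D where "countable D" "D \<subseteq> S" "\<And>x e. x \<in> S \<Longrightarrow> 0 < e \<Longrightarrow> \<exists>s\<in>D. norm (x - s) < e"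
proof -
  define q :: "rat list \<Rightarrow> finseq" where "q = (\<lambda>l. finseq_of n (\<lambda>i. real_of_rat (l ! i)))"
  \<comment> \<open>rational points need not lie in \<open>S\<close>, so near each of them one point of \<open>S\<close> is chosen\<close>
  define pick where "pick = (\<lambda>(l, m). SOME s. s \<in> S \<and> norm (s - q l) < 1 / real (Suc m))"
  define I where "I = {(l, m). \<exists>s\<in>S. norm (s - q l) < 1 / real (Suc m)}"
  have pick: "pick (l, m) \<in> S \<and> norm (pick (l, m) - q l) < 1 / real (Suc m)" if "(l, m) \<in> I" for l m
  proof -
    have "\<exists>s. s \<in> S \<and> norm (s - q l) < 1 / real (Suc m)"
      using that by (auto simp: I_def)
    from someI_ex[OF this] show ?thesis by (simp add: pick_def)
  qed
  have dense: "\<exists>l. norm (x - q l) < e" if x: "x \<in> Rn n" and e: "0 < e" for x e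
  proof -
    define e' where "e' = e / (real n + 1)"
    have "e' > 0" using e by (simp add: e'_def)
    have "\<exists>r. \<bar>coord x i - real_of_rat r\<bar> < e'" for i
    proof -
      obtain r where "coord x i < of_rat r" "of_rat r < coord x i + e'"
        using of_rat_dense[of "coord x i" "coord x i + e'"] \<open>e' > 0\<close> by auto
      then show ?thesis by (intro exI[of _ r]) (auto simp: abs_if)
    qed
    then obtain r where r: "\<And>i. \<bar>coord x i - real_of_rat (r i)\<bar> < e'" by metis
    have "norm (x - q (map r [0..<n])) \<le> real n * e'"
      using x r by (intro norm_le_coord_bound)
        (auto simp: q_def coord_finseq_of less_imp_le)
    also have "\<dots> < e"
      using e by (simp add: e'_def field_simps)
    finally show ?thesis by blast
  qed
  show thesis
  proof (rule that[of "pick ` I"])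
    show "countable (pick ` I)" by simp
    show "pick ` I \<subseteq> S" using pick by auto
    fix x and e :: real assume x: "x \<in> S" and e: "0 < e"
    obtain m where m: "1 / real (Suc m) < e / 2"
      using reals_Archimedean[of "e / 2"] e by (auto simp: inverse_eq_divide)
    obtain l where l: "norm (x - q l) < 1 / real (Suc m)"
      using dense[of x "1 / real (Suc m)"] x S by auto
    then have I: "(l, m) \<in> I" using x by (auto simp: I_def)
    have "norm (x - pick (l, m)) \<le> norm (x - q l) + norm (pick (l, m) - q l)"
      using norm_triangle_ineq4[of "x - q l" "pick (l, m) - q l"] by simp
    also have "\<dots> < e" using l pick[OF I] m by simp
    finally show "\<exists>s\<in>pick ` I. norm (x - s) < e" using I by blast
  qed
qed

text \<open>
  The interior relative to \<open>Rn n\<close>: as a subset of \<open>finseq\<close>, which is infinite-dimensional, a subset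
  of \<open>Rn n\<close> has empty topological interior.
\<close>

definition Rn_interior :: "nat \<Rightarrow> finseq set \<Rightarrow> finseq set"
  where "Rn_interior n X = {x \<in> Rn n. \<exists>e>0. \<forall>y\<in>Rn n. norm (y - x) < e \<longrightarrow> y \<in> X}"

lemma Rn_interior_subset: "Rn_interior n X \<subseteq> X"
  by (force simp: Rn_interior_def)

lemma Rn_interior_open:
  assumes "x \<in> Rn_interior n X"
  obtains e where "0 < e" "\<And>y. y \<in> Rn n \<Longrightarrow> norm (y - x) < e \<Longrightarrow> y \<in> Rn_interior n X"
proof -
  obtain e where x: "x \<in> Rn n" and e: "e > 0" "\<And>y. y \<in> Rn n \<Longrightarrow> norm (y - x) < e \<Longrightarrow> y \<in> X"
    using assms by (auto simp: Rn_interior_def)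
  show thesis
  proof (rule that[of "e / 2"])
    fix y assume y: "y \<in> Rn n" "norm (y - x) < e / 2"
    have "z \<in> X" if "z \<in> Rn n" "norm (z - y) < e / 2" for z
    proof (rule e(2)[OF that(1)])
      show "norm (z - x) < e"
        using norm_triangle_ineq[of "z - y" "y - x"] that y by simp
    qed
    then show "y \<in> Rn_interior n X"
      using y e by (auto simp: Rn_interior_def intro!: exI[of _ "e / 2"])
  qed (use e in simp)
qed

lemma Rn_interior_eq_countable_Union:
  obtains I :: "(finseq \<times> nat) set" where "countable I" "I \<subseteq> Rn n \<times> UNIV"
    "Rn_interior n X = (\<Union>(q, m)\<in>I. {x \<in> Rn n. norm (x - q) < 1 / real (Suc m)})"
proof -
  obtain D where D: "countable D" "D \<subseteq> Rn n"
    "\<And>x e. x \<in> Rn n \<Longrightarrow> 0 < e \<Longrightarrow> \<exists>s\<in>D. norm (x - s) < e"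
    using countable_dense_subset[of "Rn n" n] by blast
  define I where "I = {(q, m). q \<in> D \<and> {x \<in> Rn n. norm (x - q) < 1 / real (Suc m)} \<subseteq> X}"
  have "I \<subseteq> D \<times> UNIV" by (auto simp: I_def)
  then have "countable I" using D(1) by (rule_tac countable_subset) auto
  moreover have "I \<subseteq> Rn n \<times> UNIV" using D(2) by (auto simp: I_def)
  moreover have "Rn_interior n X = (\<Union>(q, m)\<in>I. {x \<in> Rn n. norm (x - q) < 1 / real (Suc m)})"
  proof (intro equalityI subsetI)
    fix x assume "x \<in> Rn_interior n X"
    then obtain e where x: "x \<in> Rn n" and e: "e > 0" "\<And>y. y \<in> Rn n \<Longrightarrow> norm (y - x) < e \<Longrightarrow> y \<in> X"
      by (auto simp: Rn_interior_def)
    obtain m where m: "1 / real (Suc m) < e / 2"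
      using reals_Archimedean[of "e / 2"] e by (auto simp: inverse_eq_divide)
    obtain q where q: "q \<in> D" "norm (x - q) < 1 / real (Suc m)"
      using D(3)[OF x, of "1 / real (Suc m)"] by auto
    have "y \<in> X" if "y \<in> Rn n" "norm (y - q) < 1 / real (Suc m)" for y
    proof (rule e(2)[OF that(1)])
      have "norm (y - x) \<le> norm (y - q) + norm (x - q)"
        using norm_triangle_ineq4[of "y - q" "x - q"] by simp
      then show "norm (y - x) < e" using that q m by simp
    qed
    then show "x \<in> (\<Union>(q, m)\<in>I. {x \<in> Rn n. norm (x - q) < 1 / real (Suc m)})"
      using q x by (auto simp: I_def intro!: bexI[of _ "(q, m)"])
  next
    fix x assume "x \<in> (\<Union>(q, m)\<in>I. {x \<in> Rn n. norm (x - q) < 1 / real (Suc m)})"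
    then obtain q m where qm: "(q, m) \<in> I" "x \<in> Rn n" "norm (x - q) < 1 / real (Suc m)" by auto
    have "y \<in> X" if "y \<in> Rn n" "norm (y - x) < 1 / real (Suc m) - norm (x - q)" for y
    proof -
      have "norm (y - q) \<le> norm (y - x) + norm (x - q)"
        using norm_triangle_ineq[of "y - x" "x - q"] by simp
      then show ?thesis using that qm by (auto simp: I_def)
    qed
    then show "x \<in> Rn_interior n X"
      using qm by (auto simp: Rn_interior_def intro!: exI[of _ "1 / real (Suc m) - norm (x - q)"])
  qed
  ultimately show thesis by (rule that)
qed

section \<open>Volume\<close>

abbreviation lborel_power :: "nat \<Rightarrow> (nat \<Rightarrow> real) measure"
  where "lborel_power n \<equiv> Pi\<^sub>M {..<n} (\<lambda>_. lborel)"

text \<open>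
  The measure \<open>lebesgue_Rn n\<close> before completion. Sets that are explicitly open or closed are handled
  here, where measurability can be checked in coordinates.
\<close>

definition borel_Rn :: "nat \<Rightarrow> finseq measure"
  where "borel_Rn n = embed_measure (lborel_power n) (finseq_of n)"

lemma lebesgue_Rn_eq: "lebesgue_Rn n = completion (borel_Rn n)"
  by (simp add: lebesgue_Rn_def borel_Rn_def)

lemma inj_on_finseq_of_space: "inj_on (finseq_of n) (space (lborel_power n))"
  using inj_on_finseq_of[of n] by (simp add: space_PiM)

lemma space_borel_Rn: "space (borel_Rn n) = Rn n"
  using space_lebesgue_Rn[of n] by (simp add: lebesgue_Rn_eq)

lemma in_sets_borel_RnI:
  assumes S: "S \<subseteq> Rn n" and m: "{f \<in> space (lborel_power n). finseq_of n f \<in> S} \<in> sets (lborel_power n)"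
  shows "S \<in> sets (borel_Rn n)"
proof -
  have "S = finseq_of n ` {f \<in> space (lborel_power n). finseq_of n f \<in> S}"
  proof (intro equalityI subsetI)
    fix x assume x: "x \<in> S"
    then have "x \<in> finseq_of n ` space (lborel_power n)"
      using S space_borel_Rn[of n] by (auto simp: borel_Rn_def space_embed_measure)
    then show "x \<in> finseq_of n ` {f \<in> space (lborel_power n). finseq_of n f \<in> S}"
      using x by auto
  qed auto
  then show ?thesis
    using in_sets_embed_measure[OF m, of "finseq_of n"] by (simp add: borel_Rn_def)
qed

lemma vimage_sets_borel_Rn:
  assumes "S \<in> sets (borel_Rn n)"
  shows "{f \<in> space (lborel_power n). finseq_of n f \<in> S} \<in> sets (lborel_power n)"
proof -
  have "finseq_of n \<in> lborel_power n \<rightarrow>\<^sub>M borel_Rn n"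
    unfolding borel_Rn_def by (rule measurable_embed_measure2'[OF inj_on_finseq_of_space])
  from measurable_sets[OF this assms] show ?thesis
    by (simp add: vimage_def Int_def conj_commute)
qed

lemma emeasure_borel_Rn:
  assumes "S \<in> sets (borel_Rn n)"
  shows "emeasure (borel_Rn n) S = emeasure (lborel_power n) {f \<in> space (lborel_power n). finseq_of n f \<in> S}"
proof -
  have "finseq_of n -` S \<inter> space (lborel_power n) = {f \<in> space (lborel_power n). finseq_of n f \<in> S}"
    by auto
  then show ?thesis
    using emeasure_embed_measure'[OF inj_on_finseq_of_space, of S n] assms by (simp add: borel_Rn_def)
qed

lemma emeasure_lebesgue_Rn:
  "S \<in> sets (borel_Rn n) \<Longrightarrow> emeasure (lebesgue_Rn n) S = emeasure (borel_Rn n) S"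
  by (simp add: lebesgue_Rn_eq)

lemma norm_ball_in_sets:
  assumes q: "q \<in> Rn n"
  shows "{x \<in> Rn n. norm (x - q) < r} \<in> sets (borel_Rn n)"
    and "{x \<in> Rn n. norm (x - q) \<le> r} \<in> sets (borel_Rn n)"
proof -
  have eq: "norm (finseq_of n f - q) = sqrt (\<Sum>i<n. (f i - coord q i)\<^sup>2)" for f
    using q by (subst norm_Rn[of _ n]) (auto simp: coord_finseq_of)
  have m: "(\<lambda>f. norm (finseq_of n f - q)) \<in> borel_measurable (lborel_power n)"
    unfolding eq by measurable
  show "{x \<in> Rn n. norm (x - q) < r} \<in> sets (borel_Rn n)"
    using m by (intro in_sets_borel_RnI) (auto intro: measurable_sets)
  show "{x \<in> Rn n. norm (x - q) \<le> r} \<in> sets (borel_Rn n)"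
    using m by (intro in_sets_borel_RnI) (auto intro: measurable_sets)
qed

lemma Rn_interior_in_sets: "Rn_interior n X \<in> sets (borel_Rn n)"
proof -
  obtain I :: "(finseq \<times> nat) set" where I: "countable I" "I \<subseteq> Rn n \<times> UNIV"
    "Rn_interior n X = (\<Union>(q, m)\<in>I. {x \<in> Rn n. norm (x - q) < 1 / real (Suc m)})"
    by (rule Rn_interior_eq_countable_Union)
  show ?thesis
    unfolding I(3) using I(1,2) by (intro sets.countable_UN'') (auto intro: norm_ball_in_sets)
qed

text \<open>
  The substitution rule for \<open>x \<mapsto> a + s x\<close> passes from \<open>\<real>\<close> to the product measure because a finite
  product of sigma-finite measures is determined by its values on boxes.
\<close>

lemma affine_image_borel_Rn:
  assumes s: "0 < s" and a: "a \<in> Rn n" and S: "S \<in> sets (borel_Rn n)"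
  shows "(\<lambda>x. a + s *\<^sub>R x) ` S \<in> sets (borel_Rn n)"
    and "emeasure (borel_Rn n) ((\<lambda>x. a + s *\<^sub>R x) ` S) = ennreal (s ^ n) * emeasure (borel_Rn n) S"
proof -
  interpret product_sigma_finite "\<lambda>_::nat. lborel :: real measure" ..
  let ?P = "lborel_power n"
  define r where "r = 1 / s"
  have rs: "r * s = 1" using s by (simp add: r_def)
  have r_mult: "r * (s * x) = x" for x
    using rs by (simp add: mult.assoc[symmetric])
  define g where "g = (\<lambda>f. \<lambda>i\<in>{..<n}. r * (f i - coord a i))"
  have g [measurable]: "g \<in> ?P \<rightarrow>\<^sub>M ?P"
    unfolding g_def by measurable
  have one: "emeasure lborel {x. r * (x - c) \<in> A} = ennreal s * emeasure lborel A"
    if "A \<in> sets lborel" for A :: "real set" and c :: real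
  proof -
    have [measurable]: "A \<in> sets borel" using that by simp
    have B: "{x. r * (x - c) \<in> A} \<in> sets borel" by measurable
    have "emeasure lborel {x. r * (x - c) \<in> A}
        = emeasure (density (distr lborel borel (\<lambda>x. c + s * x)) (\<lambda>_. ennreal \<bar>s\<bar>)) {x. r * (x - c) \<in> A}"
      by (rule arg_cong[OF lborel_real_affine]) (use s in simp)
    also have "\<dots> = ennreal s * emeasure (distr lborel borel (\<lambda>x. c + s * x)) {x. r * (x - c) \<in> A}"
      using s B by (subst emeasure_density_const) auto
    also have "\<dots> = ennreal s * emeasure lborel A"
      using B by (subst emeasure_distr) (simp_all add: vimage_def r_mult)
    finally show ?thesis .
  qed
  have "scale_measure (ennreal (r ^ n)) (distr ?P ?P g) = ?P"
  proof (rule PiM_eqI)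
    fix A :: "nat \<Rightarrow> real set" assume A: "\<And>i. i \<in> {..<n} \<Longrightarrow> A i \<in> sets lborel"
    have pre: "g -` (Pi\<^sub>E {..<n} A) \<inter> space ?P = Pi\<^sub>E {..<n} (\<lambda>i. {x. r * (x - coord a i) \<in> A i})"
      by (auto simp: g_def space_PiM PiE_def Pi_def)
    have "emeasure (distr ?P ?P g) (Pi\<^sub>E {..<n} A)
        = emeasure ?P (Pi\<^sub>E {..<n} (\<lambda>i. {x. r * (x - coord a i) \<in> A i}))"
      using A by (subst emeasure_distr) (auto simp only: pre g intro!: sets_PiM_I_finite)
    also have "\<dots> = (\<Prod>i<n. emeasure lborel {x. r * (x - coord a i) \<in> A i})"
    proof (rule emeasure_PiM)
      fix i assume "i \<in> {..<n}"
      then have [measurable]: "A i \<in> sets borel" using A by simp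
      show "{x. r * (x - coord a i) \<in> A i} \<in> sets lborel" by simp measurable
    qed simp
    also have "\<dots> = (\<Prod>i<n. ennreal s * emeasure lborel (A i))"
      by (intro prod.cong refl one) (use A in auto)
    also have "\<dots> = ennreal (s ^ n) * (\<Prod>i<n. emeasure lborel (A i))"
      using s by (simp add: prod.distrib ennreal_power)
    finally have "emeasure (distr ?P ?P g) (Pi\<^sub>E {..<n} A) = ennreal (s ^ n) * (\<Prod>i<n. emeasure lborel (A i))" .
    moreover have "ennreal (r ^ n) * ennreal (s ^ n) = 1"
      using s rs by (simp add: r_def ennreal_mult[symmetric] power_mult_distrib[symmetric])
    ultimately show "emeasure (scale_measure (ennreal (r ^ n)) (distr ?P ?P g)) (Pi\<^sub>E {..<n} A)
        = (\<Prod>i\<in>{..<n}. emeasure lborel (A i))"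
      by (simp add: mult.assoc[symmetric])
  qed auto
  then have scale: "ennreal (r ^ n) * emeasure (distr ?P ?P g) B = emeasure ?P B" for B
    by (metis emeasure_scale_measure)
  let ?B = "{f \<in> space ?P. finseq_of n f \<in> S}"
  have B: "?B \<in> sets ?P" by (rule vimage_sets_borel_Rn[OF S])
  have S_Rn: "S \<subseteq> Rn n" using sets.sets_into_space[OF S] by (simp add: space_borel_Rn)
  have g_eq: "finseq_of n f = a + s *\<^sub>R finseq_of n (g f)" for f
    using s a by (intro finseq_eqI) (auto simp: coord_finseq_of g_def Rn_def r_def)
  have "finseq_of n f \<in> (\<lambda>x. a + s *\<^sub>R x) ` S \<longleftrightarrow> finseq_of n (g f) \<in> S" for f
    unfolding g_eq[of f] using s by (auto simp: image_iff)
  then have pre: "{f \<in> space ?P. finseq_of n f \<in> (\<lambda>x. a + s *\<^sub>R x) ` S} = g -` ?B \<inter> space ?P"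
    using measurable_space[OF g] by auto
  show im: "(\<lambda>x. a + s *\<^sub>R x) ` S \<in> sets (borel_Rn n)"
    using S_Rn a g B by (intro in_sets_borel_RnI) (auto simp only: pre intro: measurable_sets)
  have "emeasure (borel_Rn n) ((\<lambda>x. a + s *\<^sub>R x) ` S) = emeasure (distr ?P ?P g) ?B"
    using B g unfolding emeasure_borel_Rn[OF im] pre by (simp add: emeasure_distr)
  also have "\<dots> = ennreal (s ^ n) * (ennreal (r ^ n) * emeasure (distr ?P ?P g) ?B)"
    using s by (simp add: r_def mult.assoc[symmetric] ennreal_mult[symmetric] power_mult_distrib[symmetric])
  also have "\<dots> = ennreal (s ^ n) * emeasure (borel_Rn n) S"
    by (simp add: scale emeasure_borel_Rn[OF S])
  finally show "emeasure (borel_Rn n) ((\<lambda>x. a + s *\<^sub>R x) ` S) = ennreal (s ^ n) * emeasure (borel_Rn n) S" .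
qed

lemma emeasure_norm_ball_finite:
  assumes "S \<in> sets (borel_Rn n)" "\<And>x. x \<in> S \<Longrightarrow> norm x \<le> r"
  shows "emeasure (borel_Rn n) S < \<infinity>"
proof -
  interpret product_sigma_finite "\<lambda>_::nat. lborel :: real measure" ..
  have "{f \<in> space (lborel_power n). finseq_of n f \<in> S} \<subseteq> Pi\<^sub>E {..<n} (\<lambda>_. {-\<bar>r\<bar>..\<bar>r\<bar>})"
  proof
    fix f assume f: "f \<in> {f \<in> space (lborel_power n). finseq_of n f \<in> S}"
    then have "\<bar>f i\<bar> \<le> \<bar>r\<bar>" if "i < n" for i
      using assms(2)[of "finseq_of n f"] abs_coord_le_norm[of "finseq_of n f" i] that
      by (auto simp: coord_finseq_of)
    then show "f \<in> Pi\<^sub>E {..<n} (\<lambda>_. {-\<bar>r\<bar>..\<bar>r\<bar>})"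
      using f by (auto simp: space_PiM PiE_iff abs_le_iff) (smt (verit))+
  qed
  then have "emeasure (borel_Rn n) S \<le> emeasure (lborel_power n) (Pi\<^sub>E {..<n} (\<lambda>_. {-\<bar>r\<bar>..\<bar>r\<bar>}))"
    unfolding emeasure_borel_Rn[OF assms(1)] by (intro emeasure_mono sets_PiM_I_finite) auto
  also have "\<dots> < \<infinity>"
    by (subst emeasure_PiM) (auto simp: ennreal_power)
  finally show ?thesis .
qed

lemma emeasure_norm_ball_pos:
  assumes S: "S \<in> sets (borel_Rn n)" and r: "0 < r" "\<And>x. x \<in> Rn n \<Longrightarrow> norm x < r \<Longrightarrow> x \<in> S"
  shows "0 < emeasure (borel_Rn n) S"
proof -
  interpret product_sigma_finite "\<lambda>_::nat. lborel :: real measure" ..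
  define b where "b = r / (real n + 1)"
  have b: "b > 0" "real n * b < r" using r by (auto simp: b_def field_simps)
  have "Pi\<^sub>E {..<n} (\<lambda>_. {-b..b}) \<subseteq> {f \<in> space (lborel_power n). finseq_of n f \<in> S}"
  proof
    fix f assume f: "f \<in> Pi\<^sub>E {..<n} (\<lambda>_. {-b..b})"
    then have "norm (finseq_of n f) \<le> real n * b"
      by (intro norm_le_coord_bound) (auto simp: coord_finseq_of PiE_iff abs_le_iff minus_le_iff)
    then show "f \<in> {f \<in> space (lborel_power n). finseq_of n f \<in> S}"
      using f b r(2)[of "finseq_of n f"] by (auto simp: space_PiM PiE_iff)
  qed
  then have "emeasure (lborel_power n) (Pi\<^sub>E {..<n} (\<lambda>_. {-b..b})) \<le> emeasure (borel_Rn n) S"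
    unfolding emeasure_borel_Rn[OF S] by (intro emeasure_mono vimage_sets_borel_Rn[OF S]) auto
  moreover have "0 < emeasure (lborel_power n) (Pi\<^sub>E {..<n} (\<lambda>_. {-b..b}))"
    using b by (subst emeasure_PiM) (auto simp: ennreal_power)
  ultimately show ?thesis by (rule_tac order.strict_trans2)
qed

section \<open>Measurability of convex sets\<close>

text \<open>
  The cone with apex \<open>x\<close> over the ball of radius \<open>\<eta>\<close> lies in \<open>K\<close>, and it contains a ball around \<open>t x\<close>
  of radius \<open>(1 - t) \<eta>\<close>. So a convex set with an inner point at the origin differs from its interior
  by less than any dilation, which replaces all arguments with boundaries.
\<close>

lemma scaleR_in_Rn_interior:
  assumes K: "K \<subseteq> Rn n" "convex K" and \<eta>: "\<And>x. x \<in> Rn n \<Longrightarrow> norm x < \<eta> \<Longrightarrow> x \<in> K" "0 < \<eta>"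
    and x: "x \<in> K" and t: "0 \<le> t" "t < 1"
  shows "t *\<^sub>R x \<in> Rn_interior n K"
proof -
  have "y \<in> K" if y: "y \<in> Rn n" "norm (y - t *\<^sub>R x) < (1 - t) * \<eta>" for y
  proof -
    define z where "z = (1 / (1 - t)) *\<^sub>R (y - t *\<^sub>R x)"
    have "norm z = norm (y - t *\<^sub>R x) / (1 - t)" using t by (simp only: z_def norm_scaleR) simp
    then have "norm z < \<eta>" using y t by (simp add: divide_less_eq mult.commute)
    moreover have "z \<in> Rn n" unfolding z_def using y x K by auto
    ultimately have "z \<in> K" by (rule \<eta>(1)[rotated])
    then have "t *\<^sub>R x + (1 - t) *\<^sub>R z \<in> K"
      using K(2) x t by (auto simp: convex_def)
    moreover have "t *\<^sub>R x + (1 - t) *\<^sub>R z = y" using t by (simp add: z_def)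
    ultimately show ?thesis by simp
  qed
  then show ?thesis
    using x K t \<eta>(2) by (auto simp: Rn_interior_def intro!: exI[of _ "(1 - t) * \<eta>"])
qed

text \<open>
  A bounded convex set \<open>K\<close> lies between its interior and the dilations of the interior by factors
  \<open>s > 1\<close>. The volumes of these are in the ratio \<open>s\<^sup>n\<close>, which tends to \<open>1\<close> as \<open>s\<close> tends to \<open>1\<close>, so the
  rest of \<open>K\<close> is a null set.
\<close>

lemma bounded_convex_in_sets_lebesgue_Rn:
  assumes K: "K \<subseteq> Rn n" "convex K" and \<eta>: "\<And>x. x \<in> Rn n \<Longrightarrow> norm x < \<eta> \<Longrightarrow> x \<in> K" "0 < \<eta>"
    and bdd: "\<And>x. x \<in> K \<Longrightarrow> norm x \<le> r"
  shows "K \<in> sets (lebesgue_Rn n)"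
proof -
  let ?M = "borel_Rn n"
  define O' where "O' = Rn_interior n K"
  have O: "O' \<in> sets ?M" by (simp add: O'_def Rn_interior_in_sets)
  have O_sub: "O' \<subseteq> K" by (simp add: O'_def Rn_interior_subset)
  define s where "s = (\<lambda>j::nat. 1 + 1 / real (Suc j))"
  have s: "s j > 1" for j by (simp add: s_def)
  define B where "B j = (\<lambda>x. 0 + s j *\<^sub>R x) ` O'" for j
  have B: "B j \<in> sets ?M" "emeasure ?M (B j) = ennreal (s j ^ n) * emeasure ?M O'" for j
    unfolding B_def using affine_image_borel_Rn[of "s j" 0 n O'] O s[of j] by auto
  have K_B: "K \<subseteq> B j" for j
  proof
    fix x assume "x \<in> K"
    then have "(1 / s j) *\<^sub>R x \<in> O'"
      unfolding O'_def using K \<eta> s[of j] by (intro scaleR_in_Rn_interior) auto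
    then have "0 + s j *\<^sub>R (1 / s j) *\<^sub>R x \<in> B j" unfolding B_def by blast
    then show "x \<in> B j" using s[of j] by simp
  qed
  define N where "N = (\<Inter>j. B j) - O'"
  have N: "N \<in> sets ?M" unfolding N_def using B O by auto
  have fin: "emeasure ?M O' < \<infinity>"
    by (rule emeasure_norm_ball_finite[OF O, of r]) (use O_sub bdd in auto)
  have fin_N: "emeasure ?M N < \<infinity>"
  proof -
    have "emeasure ?M N \<le> emeasure ?M (B 0)" by (rule emeasure_mono) (auto simp: N_def B)
    also have "\<dots> < \<infinity>" using fin by (simp add: B ennreal_mult_less_top)
    finally show ?thesis .
  qed
  define m where "m = measure ?M O'"
  define \<nu> where "\<nu> = measure ?M N"
  have m: "emeasure ?M O' = ennreal m" "0 \<le> m"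
    using fin by (simp_all add: m_def emeasure_eq_ennreal_measure)
  have \<nu>: "emeasure ?M N = ennreal \<nu>" "0 \<le> \<nu>"
    using fin_N by (simp_all add: \<nu>_def emeasure_eq_ennreal_measure)
  have "m + \<nu> \<le> s j ^ n * m" for j
  proof -
    have "emeasure ?M O' + emeasure ?M N = emeasure ?M (O' \<union> N)"
      by (rule plus_emeasure) (use O N in \<open>auto simp: N_def\<close>)
    also have "\<dots> \<le> emeasure ?M (B j)"
      using K_B O_sub by (intro emeasure_mono B) (auto simp: N_def)
    finally have "ennreal (m + \<nu>) \<le> ennreal (s j ^ n * m)"
      using m \<nu> s[of j] by (simp add: B ennreal_mult)
    then show ?thesis using m s[of j] by (simp add: ennreal_le_iff)
  qed
  moreover have "(\<lambda>j. s j ^ n * m) \<longlonglongrightarrow> (1 + 0) ^ n * m"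
    unfolding s_def by (intro tendsto_intros LIMSEQ_Suc[OF lim_1_over_n])
  ultimately have "m + \<nu> \<le> (1 + 0) ^ n * m"
    by (intro LIMSEQ_le_const) auto
  then have "N \<in> null_sets ?M" using N \<nu> by auto
  then show ?thesis
    unfolding lebesgue_Rn_eq
    by (intro sets_completionI[of K O' "K - O'" N]) (use O O_sub K_B in \<open>auto simp: N_def\<close>)
qed

lemma convex_in_sets_lebesgue_Rn:
  assumes K: "K \<subseteq> Rn n" "convex K" and \<eta>: "\<And>x. x \<in> Rn n \<Longrightarrow> norm x < \<eta> \<Longrightarrow> x \<in> K" "0 < \<eta>"
  shows "K \<in> sets (lebesgue_Rn n)"
proof -
  have "K \<inter> cball 0 (real (Suc m)) \<in> sets (lebesgue_Rn n)" for m
  proof (rule bounded_convex_in_sets_lebesgue_Rn)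
    show "convex (K \<inter> cball 0 (real (Suc m)))" using K by (intro convex_Int convex_cball)
    show "x \<in> K \<inter> cball 0 (real (Suc m))" if "x \<in> Rn n" "norm x < min \<eta> 1" for x
      using that \<eta>(1)[of x] by auto
    show "norm x \<le> real (Suc m)" if "x \<in> K \<inter> cball 0 (real (Suc m))" for x
      using that by auto
  qed (use K \<eta> in auto)
  then have "(\<Union>m. K \<inter> cball 0 (real (Suc m))) \<in> sets (lebesgue_Rn n)"
    by (intro sets.countable_UN) (simp add: image_subset_iff)
  moreover have "(\<Union>m. K \<inter> cball 0 (real (Suc m))) = K"
  proof -
    have "\<exists>m. norm x \<le> real (Suc m)" for x :: finseq
      using real_arch_simple[of "norm x"] by (metis le_SucI of_nat_le_iff order_trans order_refl)
    then show ?thesis by auto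
  qed
  ultimately show ?thesis by simp
qed

section \<open>Packing and covering\<close>

text \<open>
  The sets \<open>z + (s/2) X\<close>, \<open>z \<in> Z\<close>, are disjoint and lie in \<open>(a + s/2) X\<close>; compare volumes. Replacing
  \<open>X\<close> by its interior, to have measurable sets, costs a factor \<open>2\<close> in the dilation.
\<close>

lemma packing_bound:
  assumes X: "X \<subseteq> Rn n" "convex X" "\<And>x. x \<in> X \<Longrightarrow> - x \<in> X" "\<And>x. x \<in> X \<Longrightarrow> norm x \<le> \<rho>"
    and \<eta>: "\<And>x. x \<in> Rn n \<Longrightarrow> norm x < \<eta> \<Longrightarrow> x \<in> X" "0 < \<eta>"
    and a: "0 \<le> a" and s: "0 < s"
    and Z: "finite Z" "Z \<subseteq> (*\<^sub>R) a ` X"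
    and sep: "\<And>z z'. z \<in> Z \<Longrightarrow> z' \<in> Z \<Longrightarrow> z \<noteq> z' \<Longrightarrow> z - z' \<notin> (*\<^sub>R) s ` X"
  shows "real (card Z) * s ^ n \<le> (4 * a + 2 * s) ^ n"
proof -
  let ?M = "borel_Rn n"
  define O' where "O' = Rn_interior n X"
  have O: "O' \<in> sets ?M" by (simp add: O'_def Rn_interior_in_sets)
  have O_sub: "O' \<subseteq> X" by (simp add: O'_def Rn_interior_subset)
  have Z_Rn: "Z \<subseteq> Rn n" using Z X by auto
  define T where "T z = (\<lambda>x. z + (s / 2) *\<^sub>R x) ` O'" for z
  have T: "T z \<in> sets ?M" "emeasure ?M (T z) = ennreal ((s / 2) ^ n) * emeasure ?M O'" if "z \<in> Z" for z
    unfolding T_def using affine_image_borel_Rn[of "s / 2" z n O'] O s that Z_Rn by auto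
  define B where "B = (\<lambda>x. 0 + (2 * a + s) *\<^sub>R x) ` O'"
  have B: "B \<in> sets ?M" "emeasure ?M B = ennreal ((2 * a + s) ^ n) * emeasure ?M O'"
    unfolding B_def using affine_image_borel_Rn[of "2 * a + s" 0 n O'] O s a by auto
  have disj: "disjoint_family_on T Z"
  proof (unfold disjoint_family_on_def, intro ballI impI equals0I)
    fix z z' w assume z: "z \<in> Z" "z' \<in> Z" "z \<noteq> z'" and "w \<in> T z \<inter> T z'"
    then obtain u v where uv: "u \<in> X" "v \<in> X" and eq: "z + (s / 2) *\<^sub>R u = z' + (s / 2) *\<^sub>R v"
      using O_sub by (auto simp: T_def)
    have "(1/2) *\<^sub>R v + (1/2) *\<^sub>R (- u) \<in> X"
      using X(2,3) uv by (intro convexD) auto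
    moreover have "z - z' = s *\<^sub>R ((1/2) *\<^sub>R v + (1/2) *\<^sub>R (- u))"
      using eq by (simp add: algebra_simps)
    ultimately show False using sep[OF z] by blast
  qed
  have T_B: "T z \<subseteq> B" if "z \<in> Z" for z
  proof
    fix w assume "w \<in> T z"
    then obtain u where u: "u \<in> X" "w = z + (s / 2) *\<^sub>R u" using O_sub by (auto simp: T_def)
    obtain x where x: "x \<in> X" "z = a *\<^sub>R x" using Z \<open>z \<in> Z\<close> by auto
    define v where "v = (2 * a / (2 * a + s)) *\<^sub>R x + (s / (2 * a + s)) *\<^sub>R u"
    have "2 * a + s > 0" using a s by simp
    have half: "d * (1/2) * (p / d) = p / 2" if "d > 0" for d p :: real
      using that by simp
    have c: "(2 * a + s) * (1/2) * (2 * a / (2 * a + s)) = a"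
      "(2 * a + s) * (1/2) * (s / (2 * a + s)) = s / 2"
      using half[OF \<open>2 * a + s > 0\<close>, of "2 * a"] half[OF \<open>2 * a + s > 0\<close>, of s] by simp_all
    have "2 * a / (2 * a + s) + s / (2 * a + s) = 1"
      using a s by (simp add: add_divide_distrib[symmetric])
    then have "v \<in> X" unfolding v_def
      using a s u x by (intro convexD[OF X(2)]) auto
    then have "(1/2) *\<^sub>R v \<in> O'"
      unfolding O'_def using X \<eta> by (intro scaleR_in_Rn_interior) auto
    moreover have "w = 0 + (2 * a + s) *\<^sub>R ((1/2) *\<^sub>R v)"
      by (simp only: v_def u(2) x(2) scaleR_add_right scaleR_scaleR mult.assoc[symmetric] c add_0_left)
    ultimately show "w \<in> B" unfolding B_def by blast
  qed
  define m where "m = measure ?M O'"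
  have fin: "emeasure ?M O' < \<infinity>"
    by (rule emeasure_norm_ball_finite[OF O, of \<rho>]) (use O_sub X in auto)
  then have m: "emeasure ?M O' = ennreal m" "0 \<le> m"
    by (simp_all add: m_def emeasure_eq_ennreal_measure)
  have "0 < emeasure ?M O'"
  proof (rule emeasure_norm_ball_pos[OF O, of "\<eta> / 2"])
    fix x assume x: "x \<in> Rn n" "norm x < \<eta> / 2"
    then have "2 *\<^sub>R x \<in> X" using \<eta>(1)[of "2 *\<^sub>R x"] by auto
    then have "(1/2) *\<^sub>R (2 *\<^sub>R x) \<in> O'"
      unfolding O'_def using X \<eta> by (intro scaleR_in_Rn_interior) auto
    then show "x \<in> O'" by simp
  qed (use \<eta> in auto)
  then have "0 < m" using m by (cases "m = 0") auto
  have "ennreal (real (card Z) * ((s / 2) ^ n * m)) = (\<Sum>z\<in>Z. emeasure ?M (T z))"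
    using T s m by (simp add: ennreal_mult ennreal_of_nat_eq_real_of_nat)
  also have "\<dots> = emeasure ?M (\<Union>z\<in>Z. T z)"
    using T disj Z by (intro sum_emeasure) auto
  also have "\<dots> \<le> emeasure ?M B"
    using T_B B by (intro emeasure_mono) auto
  also have "\<dots> = ennreal ((2 * a + s) ^ n * m)"
    using B m a s by (simp add: ennreal_mult)
  finally have "real (card Z) * ((s / 2) ^ n * m) \<le> (2 * a + s) ^ n * m"
    using m a s by (simp add: ennreal_le_iff)
  then have "real (card Z) * (s / 2) ^ n \<le> (2 * a + s) ^ n"
    using \<open>0 < m\<close> by (simp add: mult.assoc[symmetric])
  then have "2 ^ n * (real (card Z) * (s / 2) ^ n) \<le> 2 ^ n * (2 * a + s) ^ n"
    by (intro mult_left_mono) auto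
  moreover have "2 ^ n * (real (card Z) * (s / 2) ^ n) = real (card Z) * s ^ n"
    by (simp add: power_divide)
  moreover have "2 ^ n * (2 * a + s) ^ n = (4 * a + 2 * s) ^ n"
    by (subst power_mult_distrib[symmetric]) simp
  ultimately show ?thesis by simp
qed

lemma unit_ball_in_sets: "unit_ball n \<in> sets (borel_Rn n)"
  using norm_ball_in_sets(2)[of 0 n 1] by (auto simp: unit_ball_def)

lemma unit_ball_volume:
  obtains m where "0 < m" "emeasure (borel_Rn n) (unit_ball n) = ennreal m" "measure (lebesgue_Rn n) (unit_ball n) = m"
proof -
  let ?m = "measure (borel_Rn n) (unit_ball n)"
  have "emeasure (borel_Rn n) (unit_ball n) < \<infinity>"
    by (rule emeasure_norm_ball_finite[OF unit_ball_in_sets, of _ 1]) (simp add: unit_ball_def)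
  then have eq: "emeasure (borel_Rn n) (unit_ball n) = ennreal ?m"
    by (simp add: emeasure_eq_ennreal_measure)
  moreover have "0 < emeasure (borel_Rn n) (unit_ball n)"
    by (rule emeasure_norm_ball_pos[OF unit_ball_in_sets, of 1]) (auto simp: unit_ball_def)
  ultimately have "0 < ?m" by (cases "?m = 0") auto
  moreover have "measure (lebesgue_Rn n) (unit_ball n) = ?m"
    by (simp add: measure_def emeasure_lebesgue_Rn[OF unit_ball_in_sets])
  ultimately show thesis using eq that by blast
qed

lemma covering_bound:
  assumes R: "0 < R" and t: "0 < t" and Y: "finite Y" "Y \<subseteq> Rn n"
    and cover: "\<And>x. x \<in> Rn n \<Longrightarrow> norm x \<le> R \<Longrightarrow> \<exists>y\<in>Y. norm (x - y) \<le> t"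
  shows "R ^ n \<le> real (card Y) * t ^ n"
proof -
  let ?M = "borel_Rn n"
  obtain m where m: "0 < m" "emeasure ?M (unit_ball n) = ennreal m" by (rule unit_ball_volume)
  define T where "T r z = (\<lambda>x. z + r *\<^sub>R x) ` unit_ball n" for r z
  have T: "T r z \<in> sets ?M" "emeasure ?M (T r z) = ennreal (r ^ n * m)"
    if "z \<in> Rn n" "0 < r" for z r
    unfolding T_def using affine_image_borel_Rn[of r z n "unit_ball n"] unit_ball_in_sets m that
    by (auto simp: ennreal_mult)
  have "T R 0 \<subseteq> (\<Union>y\<in>Y. T t y)"
  proof
    fix w assume "w \<in> T R 0"
    then obtain u where u: "u \<in> Rn n" "norm u \<le> 1" "w = R *\<^sub>R u" by (auto simp: T_def unit_ball_def)
    then have w: "w \<in> Rn n" "norm w \<le> R" using R by (auto intro: mult_left_le)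
    obtain y where y: "y \<in> Y" "norm (w - y) \<le> t" using cover[OF w] by blast
    have "(1 / t) *\<^sub>R (w - y) \<in> unit_ball n"
      using y w Y t by (auto simp: unit_ball_def)
    moreover have "w = y + t *\<^sub>R ((1 / t) *\<^sub>R (w - y))" using t by simp
    ultimately have "w \<in> T t y" unfolding T_def by blast
    then show "w \<in> (\<Union>y\<in>Y. T t y)" using y by blast
  qed
  then have "emeasure ?M (T R 0) \<le> emeasure ?M (\<Union>y\<in>Y. T t y)"
    using T Y t by (intro emeasure_mono sets.finite_UN) auto
  also have "\<dots> \<le> (\<Sum>y\<in>Y. emeasure ?M (T t y))"
    using T Y t by (intro emeasure_subadditive_finite) auto
  also have "\<dots> = (\<Sum>y\<in>Y. ennreal (t ^ n * m))"
    using T Y t by (intro sum.cong) auto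
  also have "\<dots> = ennreal (real (card Y) * (t ^ n * m))"
    using t m by (simp add: ennreal_mult ennreal_of_nat_eq_real_of_nat)
  finally have "ennreal (R ^ n * m) \<le> ennreal (real (card Y) * (t ^ n * m))"
    using T(2)[OF Rn_closed(5) R] by simp
  then show ?thesis using t m R by (simp add: ennreal_le_iff)
qed

text \<open>
  By convexity \<open>K\<close> contains the balls \<open>(y + D)/2\<close> with centres \<open>y/2\<close> for \<open>y \<in> Y\<close>, and these are
  disjoint when the points of \<open>Y\<close> are more than \<open>2\<close> apart.
\<close>

lemma volume_ratio_packing:
  assumes n: "1 \<le> n" and K: "K \<subseteq> Rn n" "convex K" "has_volume_ratio n K A"
  shows "1 \<le> A"
    and "finite Y \<Longrightarrow> Y \<subseteq> K \<Longrightarrow> (\<And>y y'. y \<in> Y \<Longrightarrow> y' \<in> Y \<Longrightarrow> y \<noteq> y' \<Longrightarrow> 2 < norm (y - y'))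
      \<Longrightarrow> real (card Y) \<le> (2 * A) ^ n"
proof -
  let ?L = "lebesgue_Rn n"
  obtain m where m: "0 < m" "emeasure (borel_Rn n) (unit_ball n) = ennreal m"
    "measure ?L (unit_ball n) = m" by (rule unit_ball_volume)
  have D: "unit_ball n \<subseteq> K" and fin: "emeasure ?L K < \<infinity>"
    and A: "root n (measure ?L K / m) = A"
    using K(3) m by (auto simp: has_volume_ratio_def)
  have K_sets: "K \<in> sets ?L"
    using D by (intro convex_in_sets_lebesgue_Rn[OF K(1,2), of 1]) (auto simp: unit_ball_def)
  have "A ^ n = measure ?L K / m"
    unfolding A[symmetric] using n m by (intro real_root_pow_pos2) auto
  then have vol: "emeasure ?L K = ennreal (A ^ n * m)"
    using fin m by (simp add: emeasure_eq_ennreal_measure)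
  have "A \<ge> 0" unfolding A[symmetric] using m by (intro real_root_ge_zero) auto
  have "ennreal m \<le> ennreal (A ^ n * m)"
    using emeasure_mono[OF D K_sets] by (simp add: vol emeasure_lebesgue_Rn unit_ball_in_sets m)
  then have "1 \<le> A ^ n" using m \<open>A \<ge> 0\<close> by (simp add: ennreal_le_iff)
  then show "1 \<le> A" using \<open>A \<ge> 0\<close> n
    by (metis not_le power_less_one_iff less_le_trans zero_less_one le_numeral_extra(4) leD gr0I not_one_le_zero)
  assume Y: "finite Y" "Y \<subseteq> K" and sep: "\<And>y y'. y \<in> Y \<Longrightarrow> y' \<in> Y \<Longrightarrow> y \<noteq> y' \<Longrightarrow> 2 < norm (y - y')"
  define T where "T y = (\<lambda>x. (1/2) *\<^sub>R y + (1/2) *\<^sub>R x) ` unit_ball n" for y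
  have T: "T y \<in> sets (borel_Rn n)" "emeasure ?L (T y) = ennreal ((1/2) ^ n * m)" if "y \<in> Y" for y
  proof -
    have "(1/2) *\<^sub>R y \<in> Rn n" using Y K that by auto
    from affine_image_borel_Rn[OF _ this unit_ball_in_sets, of "1/2"]
    show "T y \<in> sets (borel_Rn n)" "emeasure ?L (T y) = ennreal ((1/2) ^ n * m)"
      using m by (auto simp: T_def emeasure_lebesgue_Rn ennreal_mult)
  qed
  have T_sets: "T y \<in> sets ?L" if "y \<in> Y" for y
    using T[OF that] by (simp add: lebesgue_Rn_eq)
  have "disjoint_family_on T Y"
  proof (unfold disjoint_family_on_def, intro ballI impI equals0I)
    fix y y' w assume y: "y \<in> Y" "y' \<in> Y" "y \<noteq> y'" and "w \<in> T y \<inter> T y'"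
    then obtain u v where uv: "norm u \<le> 1" "norm v \<le> 1"
      and eq: "(1/2) *\<^sub>R y + (1/2) *\<^sub>R u = (1/2) *\<^sub>R y' + (1/2) *\<^sub>R v"
      by (auto simp: T_def unit_ball_def)
    have "(1/2) *\<^sub>R (y - y') = (1/2) *\<^sub>R (v - u)"
      using eq by (simp add: algebra_simps)
    then have "y - y' = v - u" by simp
    then show False using sep[OF y] norm_triangle_ineq4[of v u] uv by simp
  qed
  then have "(\<Sum>y\<in>Y. emeasure ?L (T y)) = emeasure ?L (\<Union>y\<in>Y. T y)"
    using T_sets Y by (intro sum_emeasure) auto
  also have "\<dots> \<le> emeasure ?L K"
  proof (rule emeasure_mono[OF _ K_sets], intro UN_least subsetI)
    fix y w assume "y \<in> Y" "w \<in> T y"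
    then show "w \<in> K" using D Y by (auto simp: T_def intro!: convexD[OF K(2)])
  qed
  finally have "ennreal (real (card Y) * ((1/2) ^ n * m)) \<le> ennreal (A ^ n * m)"
    using T m by (simp add: vol ennreal_mult ennreal_of_nat_eq_real_of_nat)
  then have "real (card Y) * (1/2) ^ n \<le> A ^ n"
    using m \<open>A \<ge> 0\<close> by (simp add: ennreal_le_iff mult.assoc[symmetric])
  then show "real (card Y) \<le> (2 * A) ^ n"
    by (simp add: power_mult_distrib field_simps)
qed

definition separated :: "real \<Rightarrow> 'a::real_normed_vector set \<Rightarrow> bool"
  where "separated \<delta> Y \<longleftrightarrow> finite Y \<and> (\<forall>y\<in>Y. \<forall>y'\<in>Y. y \<noteq> y' \<longrightarrow> \<delta> < norm (y - y'))"

text \<open>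
  A separated set of maximal cardinality is a net, since any point far from it could be added.
\<close>

lemma maximal_separated_subset:
  assumes bound: "\<And>Y. Y \<subseteq> S \<Longrightarrow> separated \<delta> Y \<Longrightarrow> real (card Y) \<le> N" and \<delta>: "0 \<le> \<delta>"
  obtains Y where "Y \<subseteq> S" "separated \<delta> Y" "\<And>x. x \<in> S \<Longrightarrow> \<exists>y\<in>Y. norm (x - y) \<le> \<delta>"
proof -
  let ?P = "\<lambda>Y. Y \<subseteq> S \<and> separated \<delta> Y"
  have empty: "?P {}" by (simp add: separated_def)
  have lt: "\<forall>Y. ?P Y \<longrightarrow> card Y < nat \<lceil>N\<rceil> + 1"
  proof (intro allI impI)
    fix Y assume "?P Y"
    then have "real (card Y) \<le> N" using bound by blast
    then show "card Y < nat \<lceil>N\<rceil> + 1" by linarith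
  qed
  obtain Y where Y: "?P Y" and max: "\<And>Y'. ?P Y' \<Longrightarrow> card Y' \<le> card Y"
    using ex_has_greatest_nat[of ?P, OF empty lt] by metis
  have "\<exists>y\<in>Y. norm (x - y) \<le> \<delta>" if x: "x \<in> S" for x
  proof (rule ccontr)
    assume far: "\<not> (\<exists>y\<in>Y. norm (x - y) \<le> \<delta>)"
    then have "x \<notin> Y" using \<delta> by auto
    have "?P (insert x Y)"
      using Y x far by (auto simp: separated_def not_le norm_minus_commute)
    from max[OF this] show False
      using \<open>x \<notin> Y\<close> Y by (simp add: separated_def)
  qed
  then show thesis using that Y by blast
qed

lemma norm_ball_packing:
  assumes R: "0 < R" and t: "0 < t" and Y: "Y \<subseteq> Rn n" "separated t Y" "\<And>y. y \<in> Y \<Longrightarrow> norm y \<le> R"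
  shows "real (card Y) * t ^ n \<le> (4 * R + 2 * t) ^ n"
proof (rule packing_bound[where X = "Rn n \<inter> cball 0 1" and \<eta> = 1 and \<rho> = 1])
  show "convex (Rn n \<inter> cball 0 1)"
    by (intro convex_Int convex_cball subspace_imp_convex subspace_Rn)
  show "Y \<subseteq> (*\<^sub>R) R ` (Rn n \<inter> cball 0 1)"
  proof
    fix y assume "y \<in> Y"
    then have "(1 / R) *\<^sub>R y \<in> Rn n \<inter> cball 0 1" using Y R by auto
    then have "R *\<^sub>R (1 / R) *\<^sub>R y \<in> (*\<^sub>R) R ` (Rn n \<inter> cball 0 1)" by blast
    then show "y \<in> (*\<^sub>R) R ` (Rn n \<inter> cball 0 1)" using R by simp
  qed
  show "y - y' \<notin> (*\<^sub>R) t ` (Rn n \<inter> cball 0 1)" if y: "y \<in> Y" "y' \<in> Y" "y \<noteq> y'" for y y'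
  proof
    assume "y - y' \<in> (*\<^sub>R) t ` (Rn n \<inter> cball 0 1)"
    then have "norm (y - y') \<le> t" using t by (auto intro: mult_left_le)
    moreover have "t < norm (y - y')" using Y(2) y unfolding separated_def by blast
    ultimately show False by simp
  qed
  show "finite Y" using Y(2) by (simp add: separated_def)
  show "Rn n \<inter> cball 0 1 \<subseteq> Rn n" by simp
  show "- x \<in> Rn n \<inter> cball 0 1" if "x \<in> Rn n \<inter> cball 0 1" for x
    using that Rn_closed(3)[of x n] by simp
  show "norm x \<le> 1" if "x \<in> Rn n \<inter> cball 0 1" for x using that by simp
  show "x \<in> Rn n \<inter> cball 0 1" if "x \<in> Rn n" "norm x < 1" for x using that by simp
  show "0 \<le> R" using R by simp
qed (use t in simp_all)

section \<open>Orthonormal bases\<close>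

definition orthonormal :: "'a::real_inner set \<Rightarrow> bool"
  where "orthonormal B \<longleftrightarrow> finite B \<and> pairwise orthogonal B \<and> (\<forall>b\<in>B. norm b = 1)"

lemma orthonormal_empty: "orthonormal {}"
  by (simp add: orthonormal_def)

lemma orthonormal_independent: "orthonormal B \<Longrightarrow> independent B"
  by (rule pairwise_orthogonal_independent) (auto simp: orthonormal_def)

lemma orthonormal_inner_sum:
  assumes "orthonormal B" "b \<in> B"
  shows "inner (\<Sum>b\<in>B. c b *\<^sub>R b) b = c b"
proof -
  have "inner (\<Sum>b\<in>B. c b *\<^sub>R b) b = (\<Sum>b'\<in>B. if b' = b then c b else 0)"
    unfolding inner_sum_left using assms
    by (intro sum.cong refl) (auto simp: orthonormal_def pairwise_def orthogonal_def norm_eq_1)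
  then show ?thesis using assms by (simp add: orthonormal_def)
qed

lemma orthonormal_norm_sum:
  assumes "orthonormal B"
  shows "(norm (\<Sum>b\<in>B. c b *\<^sub>R b))\<^sup>2 = (\<Sum>b\<in>B. (c b)\<^sup>2)"
proof -
  have expand: "inner v (\<Sum>b\<in>B. c b *\<^sub>R b) = (\<Sum>b\<in>B. c b * inner v b)" for v
    by (simp add: inner_sum_right)
  have "(norm (\<Sum>b\<in>B. c b *\<^sub>R b))\<^sup>2 = (\<Sum>b\<in>B. c b * inner (\<Sum>b\<in>B. c b *\<^sub>R b) b)"
    unfolding power2_norm_eq_inner by (rule expand)
  also have "\<dots> = (\<Sum>b\<in>B. (c b)\<^sup>2)"
    by (intro sum.cong refl) (simp add: orthonormal_inner_sum[OF assms] power2_eq_square)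
  finally show ?thesis .
qed

text \<open>
  A maximal orthonormal subset of \<open>F\<close> containing \<open>B0\<close> spans \<open>F\<close>, because the normalized remainder of a
  vector that it does not span could be added. Prescribing \<open>B0\<close> gives bases adapted to a subspace.
\<close>

lemma orthonormal_basis_extension:
  assumes F: "subspace F" "F \<subseteq> Rn n" and B0: "orthonormal B0" "B0 \<subseteq> F"
  obtains B where "orthonormal B" "B0 \<subseteq> B" "B \<subseteq> F" "card B = dim F"
    "\<And>x. x \<in> F \<Longrightarrow> x = (\<Sum>b\<in>B. inner x b *\<^sub>R b)"
proof -
  let ?P = "\<lambda>B. orthonormal B \<and> B0 \<subseteq> B \<and> B \<subseteq> F"
  have lt: "card B < n + 1" if "?P B" for B
  proof -
    have "Rn n \<subseteq> span (unit_seq ` {..<n})"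
    proof
      fix x assume "x \<in> Rn n"
      then have "x = (\<Sum>i<n. coord x i *\<^sub>R unit_seq i)" by (rule Rn_eq_sum)
      also have "\<dots> \<in> span (unit_seq ` {..<n})"
        by (intro span_sum span_scale span_base) auto
      finally show "x \<in> span (unit_seq ` {..<n})" .
    qed
    then have "card B \<le> card (unit_seq ` {..<n})"
      using independent_span_bound[OF _ orthonormal_independent, of "unit_seq ` {..<n}" B] that F by auto
    also have "\<dots> \<le> n" using card_image_le[of "{..<n}" unit_seq] by simp
    finally show ?thesis by simp
  qed
  have "?P B0" using B0 by simp
  then obtain B where B: "?P B" and max: "\<And>B'. ?P B' \<Longrightarrow> card B' \<le> card B"
    using ex_has_greatest_nat[of ?P B0 card "n + 1"] lt by metis
  have expand: "x = (\<Sum>b\<in>B. inner x b *\<^sub>R b)" if x: "x \<in> F" for x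
  proof (rule ccontr)
    define y where "y = x - (\<Sum>b\<in>B. inner x b *\<^sub>R b)"
    assume "x \<noteq> (\<Sum>b\<in>B. inner x b *\<^sub>R b)"
    then have "y \<noteq> 0" by (simp add: y_def)
    have "y \<in> F"
      unfolding y_def using x B F(1) by (intro subspace_diff subspace_sum subspace_scale) auto
    have orth: "inner y b = 0" if "b \<in> B" for b
      using B that by (simp add: y_def inner_diff_left orthonormal_inner_sum)
    define u where "u = (1 / norm y) *\<^sub>R y"
    have "u \<in> F" unfolding u_def using \<open>y \<in> F\<close> F(1) by (simp add: subspace_scale)
    have "norm u = 1" using \<open>y \<noteq> 0\<close> by (simp add: u_def)
    have u_orth: "inner u b = 0" if "b \<in> B" for b using orth[OF that] by (simp add: u_def)
    have "u \<notin> B"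
      using u_orth[of u] \<open>norm u = 1\<close> by (auto simp: norm_eq_1)
    have "?P (insert u B)"
      using B \<open>u \<in> F\<close> \<open>norm u = 1\<close> u_orth
      by (auto simp: orthonormal_def pairwise_insert orthogonal_def inner_commute)
    from max[OF this] show False
      using \<open>u \<notin> B\<close> B by (simp add: orthonormal_def)
  qed
  have "dim F = card B"
  proof (rule dim_unique)
    show "F \<subseteq> span B"
    proof
      fix x assume "x \<in> F"
      have "(\<Sum>b\<in>B. inner x b *\<^sub>R b) \<in> span B"
        by (intro span_sum span_scale span_base)
      then show "x \<in> span B" using expand[OF \<open>x \<in> F\<close>] by simp
    qed
  qed (use B orthonormal_independent[of B] in auto)
  then show thesis
    by (intro that[OF _ _ _ _ expand]) (use B in simp_all)
qed

text \<open>
  Here \<open>\<pi>\<close> is the orthogonal projection onto \<open>E\<close>, and \<open>T\<close> is the projection onto the orthogonal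
  complement of \<open>E\<close> written in coordinates, so that the packing bounds in \<open>\<real>\<^sup>n\<^sup>-\<^sup>k\<close> apply to its values.
\<close>

lemma orthogonal_projection_coordinates:
  assumes E: "subspace E" "E \<subseteq> Rn n" "dim E = k"
  obtains \<pi> T :: "finseq \<Rightarrow> finseq" where "linear \<pi>" "linear T"
    "\<And>x. \<pi> x \<in> E" "\<And>x. T x \<in> Rn (n - k)"
    "\<And>x. x \<in> Rn n \<Longrightarrow> norm (T x) = norm (x - \<pi> x)"
    "\<And>x. x \<in> Rn n \<Longrightarrow> norm (\<pi> x) \<le> norm x" "\<And>x. x \<in> Rn n \<Longrightarrow> norm (T x) \<le> norm x"
proof -
  obtain C where C: "orthonormal C" "C \<subseteq> E" "card C = k"
    by (rule orthonormal_basis_extension[OF E(1,2) orthonormal_empty empty_subsetI]) (use E(3) in simp)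
  obtain B where B: "orthonormal B" "C \<subseteq> B" "card B = n"
    and expand: "\<And>x. x \<in> Rn n \<Longrightarrow> x = (\<Sum>b\<in>B. inner x b *\<^sub>R b)"
    by (rule orthonormal_basis_extension[OF subspace_Rn order_refl C(1) order_trans[OF C(2) E(2)]])
      (simp add: dim_Rn)
  have fin: "finite B" "finite C" using B C by (auto simp: orthonormal_def)
  have sub: "orthonormal (B - C)" using B by (auto simp: orthonormal_def intro: pairwise_subset)
  have "card (B - C) = n - k" using B C fin by (simp add: card_Diff_subset)
  then obtain f where f: "bij_betw f {..<n - k} (B - C)"
    using ex_bij_betw_nat_finite[of "B - C"] fin by (auto simp: atLeast0LessThan)
  define \<pi> where "\<pi> x = (\<Sum>b\<in>C. inner x b *\<^sub>R b)" for x
  define T where "T x = (\<Sum>i<n - k. inner x (f i) *\<^sub>R unit_seq i)" for x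
  have T_coord: "coord (T x) i = (if i < n - k then inner x (f i) else 0)" for x i
    by (simp add: T_def coord_sum coord_unit_seq if_distrib cong: if_cong)
  have T_Rn: "T x \<in> Rn (n - k)" for x by (simp add: Rn_def T_coord)
  have T_norm: "(norm (T x))\<^sup>2 = (\<Sum>b\<in>B - C. (inner x b)\<^sup>2)" for x
  proof -
    have "(norm (T x))\<^sup>2 = (\<Sum>i<n - k. (inner x (f i))\<^sup>2)"
      by (simp add: norm_Rn[OF T_Rn] T_coord sum_nonneg)
    also have "\<dots> = (\<Sum>b\<in>B - C. (inner x b)\<^sup>2)"
      by (rule sum.reindex_bij_betw[OF f])
    finally show ?thesis .
  qed
  have split: "x - \<pi> x = (\<Sum>b\<in>B - C. inner x b *\<^sub>R b)" if "x \<in> Rn n" for x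
  proof -
    have "x = (\<Sum>b\<in>B - C. inner x b *\<^sub>R b) + \<pi> x"
      unfolding \<pi>_def by (rule trans[OF expand[OF that] sum.subset_diff[OF B(2) fin(1)]])
    then show ?thesis by (metis add_diff_cancel_right')
  qed
  show thesis
  proof (rule that)
    show "linear \<pi>" unfolding \<pi>_def
      by (intro linear_compose_sum ballI linearI) (auto simp: inner_add_left scaleR_add_left)
    show "linear T" unfolding T_def
      by (intro linear_compose_sum ballI linearI) (auto simp: inner_add_left scaleR_add_left)
    show "\<pi> x \<in> E" for x
      unfolding \<pi>_def using C E(1) by (intro subspace_sum subspace_scale) auto
    show "T x \<in> Rn (n - k)" for x by (rule T_Rn)
    fix x assume x: "x \<in> Rn n"
    have "(norm (T x))\<^sup>2 = (norm (x - \<pi> x))\<^sup>2"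
      unfolding T_norm split[OF x] by (rule orthonormal_norm_sum[OF sub, symmetric])
    then show "norm (T x) = norm (x - \<pi> x)" by (simp add: power2_eq_iff_nonneg)
    have "(norm (\<pi> x))\<^sup>2 = (\<Sum>b\<in>C. (inner x b)\<^sup>2)"
      unfolding \<pi>_def by (rule orthonormal_norm_sum[OF C(1)])
    also have "\<dots> \<le> (\<Sum>b\<in>B. (inner x b)\<^sup>2)"
      using fin B by (intro sum_mono2) auto
    also have "\<dots> = (norm x)\<^sup>2"
      using orthonormal_norm_sum[OF B(1), of "\<lambda>b. inner x b"] expand[OF x] by simp
    finally show "norm (\<pi> x) \<le> norm x" by (rule power2_le_imp_le) simp
    have "(norm (T x))\<^sup>2 \<le> (\<Sum>b\<in>B. (inner x b)\<^sup>2)"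
      unfolding T_norm using fin B by (intro sum_mono2) auto
    also have "\<dots> = (norm x)\<^sup>2"
      using orthonormal_norm_sum[OF B(1), of "\<lambda>b. inner x b"] expand[OF x] by simp
    finally show "norm (T x) \<le> norm x" by (rule power2_le_imp_le) simp
  qed
qed

section \<open>Separated sets in a body with one bounded section\<close>

text \<open>
  A symmetric convex set can be enlarged to one with interior, at the cost of a factor \<open>2\<close> for the
  section by \<open>E\<close>: take \<open>L' = L + D\<^sub>E/2 + Y\<close> with \<open>Y\<close> the orthogonal complement of \<open>L \<union> E\<close>. If \<open>l + e + y\<close> lies
  in \<open>E\<close>, then \<open>y\<close> is orthogonal to itself, hence \<open>y = 0\<close> and \<open>l \<in> L \<inter> E\<close>.
\<close>

lemma fatten_symmetric_convex:
  assumes L: "L \<subseteq> Rn n" "convex L" "\<And>x. x \<in> L \<Longrightarrow> - x \<in> L" "0 \<in> L"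
    and E: "subspace E" "E \<subseteq> Rn n" and bdd: "\<And>x. x \<in> L \<Longrightarrow> x \<in> E \<Longrightarrow> norm x \<le> 1 / 2"
  obtains L' \<eta> where "L \<subseteq> L'" "L' \<subseteq> Rn n" "convex L'" "\<And>x. x \<in> L' \<Longrightarrow> - x \<in> L'"
    "\<And>x. x \<in> Rn n \<Longrightarrow> norm x < \<eta> \<Longrightarrow> x \<in> L'" "0 < \<eta>"
    "\<And>x. x \<in> L' \<Longrightarrow> x \<in> E \<Longrightarrow> norm x \<le> 1"
proof -
  define Y where "Y = {y \<in> Rn n. \<forall>v\<in>L \<union> E. inner y v = 0}"
  define L' where "L' = {l + e + y | l e y. l \<in> L \<and> e \<in> E \<and> norm e \<le> 1 / 2 \<and> y \<in> Y}"
  have L'I: "l + e + y \<in> L'" if "l \<in> L" "e \<in> E" "norm e \<le> 1 / 2" "y \<in> Y" for l e y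
    using that by (auto simp: L'_def)
  have Y: "subspace Y" "0 \<in> Y"
    by (auto simp: Y_def subspace_def inner_add_left Rn_closed)
  have E0: "0 \<in> E" using E subspace_0 by blast
  have L'_Rn: "L' \<subseteq> Rn n"
    using L(1) E(2) by (auto simp: L'_def Y_def intro!: Rn_closed(1))
  have "L \<subseteq> L'" using L'I[of _ 0 0] E0 Y by auto
  have "Y \<subseteq> L'" using L'I[of 0 0] E0 L by auto
  have L'_convex: "convex L'"
  proof (rule convexI)
    fix x x' :: finseq and u v :: real
    assume xx: "x \<in> L'" "x' \<in> L'" and uv: "0 \<le> u" "0 \<le> v" "u + v = 1"
    from xx obtain l e y l' e' y' where x: "x = l + e + y" "l \<in> L" "e \<in> E" "norm e \<le> 1 / 2" "y \<in> Y"
      and x': "x' = l' + e' + y'" "l' \<in> L" "e' \<in> E" "norm e' \<le> 1 / 2" "y' \<in> Y"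
      by (auto simp: L'_def)
    have "u *\<^sub>R l + v *\<^sub>R l' \<in> L" using L x x' uv by (intro convexD) auto
    moreover have "u *\<^sub>R e + v *\<^sub>R e' \<in> E \<inter> cball 0 (1 / 2)"
      using E x x' uv by (intro convexD convex_Int convex_cball subspace_imp_convex) auto
    moreover have "u *\<^sub>R y + v *\<^sub>R y' \<in> Y"
      using Y x x' uv by (intro convexD subspace_imp_convex) auto
    moreover have "u *\<^sub>R x + v *\<^sub>R x'
        = (u *\<^sub>R l + v *\<^sub>R l') + (u *\<^sub>R e + v *\<^sub>R e') + (u *\<^sub>R y + v *\<^sub>R y')"
      by (simp add: x x' algebra_simps)
    ultimately show "u *\<^sub>R x + v *\<^sub>R x' \<in> L'" by (auto intro: L'I)
  qed
  have L'_sym: "- x \<in> L'" if "x \<in> L'" for x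
  proof -
    from that obtain l e y where x: "x = l + e + y" "l \<in> L" "e \<in> E" "norm e \<le> 1 / 2" "y \<in> Y"
      by (auto simp: L'_def)
    have "- l + - e + - y \<in> L'"
      using x L E Y by (intro L'I) (auto simp: subspace_neg)
    then show ?thesis by (simp add: x)
  qed
  have L'_E: "norm x \<le> 1" if x: "x \<in> L'" "x \<in> E" for x
  proof -
    from x obtain l e y where x': "x = l + e + y" "l \<in> L" "e \<in> E" "norm e \<le> 1 / 2" "y \<in> Y"
      by (auto simp: L'_def)
    have "inner y v = 0" if "v \<in> L \<union> E" for v
      using x'(5) that by (simp add: Y_def)
    from this[of x] this[of e] this[of l] have "inner y (x - e - l) = 0"
      using x(2) x'(2,3) by (simp add: inner_diff_right)
    moreover have "x - e - l = y" by (simp add: x')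
    ultimately have "y = 0" by simp
    then have "l = x - e" using x' by simp
    then have "l \<in> E" using subspace_diff[OF E(1) x(2) x'(3)] by simp
    then have "norm l \<le> 1 / 2" using bdd x' by simp
    then show ?thesis using norm_triangle_ineq[of l e] x' \<open>y = 0\<close> by simp
  qed
  have star: "t *\<^sub>R x \<in> L'" if "x \<in> L'" "\<bar>t\<bar> \<le> 1" for t x
  proof -
    have "\<bar>t\<bar> *\<^sub>R z + (1 - \<bar>t\<bar>) *\<^sub>R 0 \<in> L'" if "z \<in> L'" for z
      using \<open>L \<subseteq> L'\<close> L(4) \<open>\<bar>t\<bar> \<le> 1\<close> that by (intro convexD[OF L'_convex]) auto
    from this[OF that(1)] this[OF L'_sym[OF that(1)]] show ?thesis
      by (cases "t \<ge> 0") auto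
  qed
  \<comment> \<open>the vectors absorbed by \<open>L'\<close> form a subspace; once it is everything, \<open>L'\<close> contains a ball\<close>
  define A where "A = {x. \<exists>t>0. t *\<^sub>R x \<in> L'}"
  have A: "subspace A"
  proof (rule subspaceI)
    show "0 \<in> A" using \<open>L \<subseteq> L'\<close> L(4) by (auto simp: A_def intro!: exI[of _ 1])
    fix x assume "x \<in> A"
    then obtain t where t: "t > 0" "t *\<^sub>R x \<in> L'" by (auto simp: A_def)
    show "c *\<^sub>R x \<in> A" for c
    proof -
      have "(c / (1 + \<bar>c\<bar>)) *\<^sub>R t *\<^sub>R x \<in> L'"
        by (rule star[OF t(2)]) (auto simp: abs_divide divide_simps)
      then have "(t / (1 + \<bar>c\<bar>)) *\<^sub>R c *\<^sub>R x \<in> L'" by (simp add: mult.commute)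
      then show ?thesis using t by (auto simp: A_def intro!: exI[of _ "t / (1 + \<bar>c\<bar>)"])
    qed
    fix y assume "y \<in> A"
    then obtain s where s: "s > 0" "s *\<^sub>R y \<in> L'" by (auto simp: A_def)
    define r where "r = min t s"
    have "(r / t) *\<^sub>R t *\<^sub>R x \<in> L'"
      by (rule star[OF t(2)]) (use t(1) s(1) in \<open>simp add: r_def min_def\<close>)
    moreover have "(r / s) *\<^sub>R s *\<^sub>R y \<in> L'"
      by (rule star[OF s(2)]) (use t(1) s(1) in \<open>simp add: r_def min_def\<close>)
    ultimately have rr: "r *\<^sub>R x \<in> L'" "r *\<^sub>R y \<in> L'" using t s by simp_all
    have "(1/2) *\<^sub>R r *\<^sub>R x + (1/2) *\<^sub>R r *\<^sub>R y \<in> L'" by (rule convexD[OF L'_convex rr]) auto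
    then have "(r / 2) *\<^sub>R (x + y) \<in> L'" by (simp add: scaleR_add_right)
    moreover have "r / 2 > 0" using t s by (simp add: r_def)
    ultimately show "x + y \<in> A" unfolding A_def by blast
  qed
  have "L \<subseteq> A" using \<open>L \<subseteq> L'\<close> by (auto simp: A_def intro!: exI[of _ 1])
  moreover have Y_A: "Y \<subseteq> A" using \<open>Y \<subseteq> L'\<close> by (auto simp: A_def intro!: exI[of _ 1])
  moreover have "E \<subseteq> A"
  proof
    fix e assume e: "e \<in> E"
    define t where "t = 1 / (2 * (norm e + 1))"
    have "t > 0" by (simp add: t_def add_nonneg_pos)
    have "norm (t *\<^sub>R e) \<le> 1 / 2" by (simp add: t_def divide_simps add_nonneg_pos)
    then have "0 + t *\<^sub>R e + 0 \<in> L'" using L E e Y by (intro L'I) (auto simp: subspace_scale)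
    then show "e \<in> A" using \<open>t > 0\<close> by (auto simp: A_def)
  qed
  ultimately have span_A: "span (L \<union> E) \<subseteq> A" by (intro span_minimal A) auto
  have "span (L \<union> E) \<subseteq> Rn n" using L E by (intro span_minimal subspace_Rn) auto
  then obtain C where C: "orthonormal C" "C \<subseteq> span (L \<union> E)"
    and expC: "\<And>x. x \<in> span (L \<union> E) \<Longrightarrow> x = (\<Sum>b\<in>C. inner x b *\<^sub>R b)"
    by (rule orthonormal_basis_extension[OF subspace_span _ orthonormal_empty empty_subsetI]) blast
  obtain B where B: "orthonormal B" "C \<subseteq> B" "B \<subseteq> Rn n"
    and expB: "\<And>x. x \<in> Rn n \<Longrightarrow> x = (\<Sum>b\<in>B. inner x b *\<^sub>R b)"
    by (rule orthonormal_basis_extension[OF subspace_Rn order_refl C(1)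
          order_trans[OF C(2) \<open>span (L \<union> E) \<subseteq> Rn n\<close>]]) blast
  have "b \<in> A" if b: "b \<in> B" for b
  proof (cases "b \<in> C")
    case True
    then show ?thesis using C span_A by auto
  next
    case False
    have "inner b v = 0" if v: "v \<in> L \<union> E" for v
    proof -
      have "inner b v = inner b (\<Sum>c\<in>C. inner v c *\<^sub>R c)"
        using expC[OF span_base[OF v]] by simp
      also have "\<dots> = (\<Sum>c\<in>C. inner v c * inner b c)" by (simp add: inner_sum_right)
      also have "\<dots> = 0"
      proof (intro sum.neutral ballI)
        fix c assume "c \<in> C"
        then have "b \<noteq> c" "c \<in> B" using False B by auto
        then show "inner v c * inner b c = 0"
          using B(1) b by (auto simp: orthonormal_def pairwise_def orthogonal_def)
      qed
      finally show ?thesis .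
    qed
    then have "b \<in> Y" using b B by (auto simp: Y_def)
    then show ?thesis using Y_A by blast
  qed
  then have Rn_A: "Rn n \<subseteq> A"
    using expB A by (metis (no_types, lifting) subsetI subspace_sum subspace_scale)
  have "\<forall>i. \<exists>t>0. i < n \<longrightarrow> t *\<^sub>R unit_seq i \<in> L'"
  proof
    fix i
    show "\<exists>t>0. i < n \<longrightarrow> t *\<^sub>R unit_seq i \<in> L'"
    proof (cases "i < n")
      case True
      then have "unit_seq i \<in> A" using Rn_A by (auto simp: Rn_def coord_unit_seq)
      then show ?thesis by (auto simp: A_def)
    qed (auto intro: exI[of _ 1])
  qed
  then obtain t where t: "\<And>i. t i > 0" "\<And>i. i < n \<Longrightarrow> t i *\<^sub>R unit_seq i \<in> L'" by metis
  define m where "m = Min (insert 1 (t ` {..<n}))"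
  have m: "m > 0" "\<And>i. i < n \<Longrightarrow> m \<le> t i" using t by (auto simp: m_def)
  define \<eta> where "\<eta> = m / (real n + 1)"
  have "\<eta> > 0" using m by (simp add: \<eta>_def)
  have ball: "x \<in> L'" if x: "x \<in> Rn n" "norm x < \<eta>" for x
  proof (cases "n = 0")
    case True
    then have "x = 0" using x by (auto simp: Rn_def intro: finseq_eqI)
    then show ?thesis using \<open>L \<subseteq> L'\<close> L(4) by auto
  next
    case False
    have pt: "(real n * coord x i) *\<^sub>R unit_seq i \<in> L'" if i: "i < n" for i
    proof -
      have "real n * \<bar>coord x i\<bar> \<le> real n * \<eta>"
        using abs_coord_le_norm[of x i] x by (intro mult_left_mono) auto
      also have "\<dots> \<le> m" using m by (simp add: \<eta>_def field_simps)
      also have "\<dots> \<le> t i" by (rule m(2)[OF i])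
      finally have le: "real n * \<bar>coord x i\<bar> \<le> t i" .
      have "((real n * coord x i) / t i) *\<^sub>R t i *\<^sub>R unit_seq i \<in> L'"
        by (rule star[OF t(2)[OF i]]) (use t(1)[of i] le in \<open>simp add: abs_mult abs_divide divide_le_eq\<close>)
      then show ?thesis using t(1)[of i] by simp
    qed
    have "(\<Sum>i<n. (1 / real n) *\<^sub>R (real n * coord x i) *\<^sub>R unit_seq i) \<in> L'"
      using pt False by (intro convex_sum L'_convex) auto
    then show ?thesis using Rn_eq_sum[OF x(1)] False by simp
  qed
  show thesis
    by (rule that[OF \<open>L \<subseteq> L'\<close> L'_Rn L'_convex L'_sym ball \<open>\<eta> > 0\<close> L'_E])
qed

lemma symmetric_convex_abs_combination:
  fixes L :: "'a::real_vector set"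
  assumes L: "convex L" "\<And>x. x \<in> L \<Longrightarrow> - x \<in> L" and x: "x \<in> L" "y \<in> L" and st: "\<bar>s\<bar> + \<bar>t\<bar> \<le> 1"
  shows "s *\<^sub>R x + t *\<^sub>R y \<in> L"
proof -
  have "(1/2) *\<^sub>R x + (1/2) *\<^sub>R (- x) \<in> L"
    by (rule convexD[OF L(1)]) (use L(2) x in auto)
  then have "0 \<in> L" by simp
  have sgn: "\<exists>z'\<in>L. r *\<^sub>R z = \<bar>r\<bar> *\<^sub>R z'" if "z \<in> L" for z :: 'a and r :: real
  proof (cases "r \<ge> 0")
    case True
    then show ?thesis using that by auto
  next
    case False
    then show ?thesis using L(2)[OF that] by (intro bexI[of _ "- z"]) auto
  qed
  obtain x' y' where x': "x' \<in> L" "s *\<^sub>R x = \<bar>s\<bar> *\<^sub>R x'" and y': "y' \<in> L" "t *\<^sub>R y = \<bar>t\<bar> *\<^sub>R y'"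
    using sgn[OF x(1), of s] sgn[OF x(2), of t] by blast
  show ?thesis
  proof (cases "\<bar>s\<bar> + \<bar>t\<bar> = 0")
    case True
    then have "s = 0" "t = 0" by linarith+
    then show ?thesis using \<open>0 \<in> L\<close> by simp
  next
    case False
    define r where "r = \<bar>s\<bar> + \<bar>t\<bar>"
    have "r > 0" "r \<le> 1" using False st by (auto simp: r_def)
    have "(\<bar>s\<bar> / r) *\<^sub>R x' + (\<bar>t\<bar> / r) *\<^sub>R y' \<in> L"
      by (rule convexD[OF L(1) x'(1) y'(1)])
        (use \<open>r > 0\<close> in \<open>auto simp: add_divide_distrib[symmetric] r_def[symmetric]\<close>)
    from convexD[OF L(1) this \<open>0 \<in> L\<close>, of r "1 - r"]
    show ?thesis using \<open>r > 0\<close> \<open>r \<le> 1\<close> by (simp add: x' y' scaleR_add_right)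
  qed
qed

text \<open>
  Let \<open>D\<^sub>E\<close> be the unit ball of \<open>E\<close> and \<open>N\<close> the cardinality of \<open>I\<close>. Two counts are played against each other.

  First, cover the projection of \<open>I\<close> to the orthogonal complement of \<open>E\<close>, of dimension \<open>n - k\<close>, by at most
  \<open>(10 R)\<^sup>n\<^sup>-\<^sup>k\<close> sets of diameter \<open>1\<close>. One of them carries a subset \<open>F\<close> of \<open>I\<close> of at least \<open>N / (10 R)\<^sup>n\<^sup>-\<^sup>k\<close>
  points. Fix \<open>y0 \<in> F\<close>. For \<open>y \<in> F\<close>, moving \<open>y - y0 \<in> 2 L\<close> into \<open>E\<close> takes a correction \<open>w y\<close> of norm at most \<open>1\<close>.

  Second, the vectors \<open>w y1 + y/R\<close> with \<open>y1 \<in> F\<close> and \<open>y \<in> I\<close> all lie in \<open>2 X\<close> for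
  \<open>X = D \<inter> (2 L + 3 R D\<^sub>E)\<close>, and no two of them differ by an element of \<open>X/R\<close>. For equal \<open>y1\<close> this holds as
  \<open>X \<subseteq> D\<close>. For different \<open>y1, y1'\<close> such a coincidence puts \<open>w y1 - w y1'\<close> in \<open>(4/R) L + 3 D\<^sub>E\<close>, because
  elements of \<open>X\<close> can be exchanged for elements of \<open>2 L\<close> at the price of an element of \<open>3 R D\<^sub>E\<close>. Then the
  projection of \<open>y1 - y1'\<close> to \<open>E\<close> is within distance \<open>3\<close> of \<open>6 L \<inter> E\<close>, so it is short, contrary to the
  separation of \<open>I\<close>. Hence \<open>card F \<cdot> N \<le> (10 R)\<^sup>n\<close> by packing, whatever the shape of \<open>X\<close>.

  Using \<open>X\<close> instead of \<open>D\<close> is essential, since \<open>L\<close> may be nearly tangent to \<open>E\<close>: then \<open>L + D\<close> has huge sections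
  by \<open>E\<close> even if \<open>L\<close> has not.
\<close>

lemma separated_in_fat_body:
  assumes L: "L \<subseteq> Rn n" "convex L" "\<And>x. x \<in> L \<Longrightarrow> - x \<in> L"
    and \<eta>: "\<And>x. x \<in> Rn n \<Longrightarrow> norm x < \<eta> \<Longrightarrow> x \<in> L" "0 < \<eta>"
    and E: "subspace E" "E \<subseteq> Rn n" "dim E = k"
    and bdd: "\<And>x. x \<in> L \<Longrightarrow> x \<in> E \<Longrightarrow> norm x \<le> 1"
    and R: "1 \<le> R" and I: "separated 12 I" "I \<subseteq> L" "\<And>y. y \<in> I \<Longrightarrow> norm y \<le> R"
  shows "(real (card I))\<^sup>2 \<le> (10 * R) ^ (n - k) * (10 * R) ^ n"
proof (cases "I = {}")
  case True
  then show ?thesis using R by simp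
next
  case False
  obtain \<pi> T :: "finseq \<Rightarrow> finseq" where lin: "linear \<pi>" "linear T"
    and \<pi>_E: "\<And>x. \<pi> x \<in> E" and T_Rn: "\<And>x. T x \<in> Rn (n - k)"
    and T_norm: "\<And>x. x \<in> Rn n \<Longrightarrow> norm (T x) = norm (x - \<pi> x)"
    and \<pi>_norm: "\<And>x. x \<in> Rn n \<Longrightarrow> norm (\<pi> x) \<le> norm x"
    and T_le: "\<And>x. x \<in> Rn n \<Longrightarrow> norm (T x) \<le> norm x"
    using orthogonal_projection_coordinates[OF E] by metis
  have fin: "finite I" and I_Rn: "\<And>y. y \<in> I \<Longrightarrow> y \<in> Rn n"
    and I_L: "\<And>y. y \<in> I \<Longrightarrow> y \<in> L" using I L by (auto simp: separated_def)
  have I_sep: "12 < norm (y - y')" if "y \<in> I" "y' \<in> I" "y \<noteq> y'" for y y'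
    using I(1) that unfolding separated_def by blast
  have abs_convex: "s *\<^sub>R x + t *\<^sub>R y \<in> L" if "x \<in> L" "y \<in> L" "\<bar>s\<bar> + \<bar>t\<bar> \<le> 1" for x y s t
    by (rule symmetric_convex_abs_combination[OF L(2,3) that])
  have "0 \<in> L" using \<eta>(1)[of 0] \<eta>(2) Rn_closed(5) by simp
  have shrink: "s *\<^sub>R x \<in> L" if "x \<in> L" "\<bar>s\<bar> \<le> 1" for x s
    using abs_convex[OF that(1) that(1), of s 0] that by simp

  have card_A: "real (card A) \<le> (10 * R) ^ (n - k)" if A: "A \<subseteq> T ` I" "separated (1/2) A" for A
  proof -
    have "real (card A) * (1/2) ^ (n - k) \<le> (4 * R + 2 * (1/2)) ^ (n - k)"
    proof (rule norm_ball_packing)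
      show "norm a \<le> R" if a: "a \<in> A" for a
      proof -
        obtain y where y: "y \<in> I" "a = T y" using A a by blast
        then show ?thesis using T_le[OF I_Rn[OF y(1)]] I(3)[OF y(1)] by simp
      qed
      show "A \<subseteq> Rn (n - k)" using A(1) T_Rn by blast
      show "0 < R" using R by simp
    qed (use A in simp_all)
    also have "\<dots> \<le> (5 * R) ^ (n - k)" using R by (intro power_mono) auto
    finally have "real (card A) * (1/2) ^ (n - k) * 2 ^ (n - k) \<le> (5 * R) ^ (n - k) * 2 ^ (n - k)"
      by (rule mult_right_mono) simp
    moreover have "real (card A) * (1/2) ^ (n - k) * 2 ^ (n - k) = real (card A)"
      by (simp add: power_divide)
    moreover have "(5 * R) ^ (n - k) * 2 ^ (n - k) = (10 * R) ^ (n - k)"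
      by (subst power_mult_distrib[symmetric]) simp
    ultimately show ?thesis by (simp only:)
  qed
  obtain A where A: "A \<subseteq> T ` I" "separated (1/2) A" and near: "\<And>x. x \<in> T ` I \<Longrightarrow> \<exists>a\<in>A. norm (x - a) \<le> 1/2"
    using maximal_separated_subset[of "T ` I" "1/2", OF card_A] by auto
  have "\<forall>y\<in>I. \<exists>a\<in>A. norm (T y - a) \<le> 1/2" using near by blast
  then obtain c where c: "\<And>y. y \<in> I \<Longrightarrow> c y \<in> A" "\<And>y. y \<in> I \<Longrightarrow> norm (T y - c y) \<le> 1/2" by metis
  have fin_A: "finite A" using A by (simp add: separated_def)
  define F where "F a = {y \<in> I. c y = a}" for a
  have "A \<noteq> {}" using False c by auto
  \<comment> \<open>the most populated cell\<close>
  define m where "m = Max ((\<lambda>a. card (F a)) ` A)"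
  have "m \<in> (\<lambda>a. card (F a)) ` A" unfolding m_def using fin_A \<open>A \<noteq> {}\<close> by (intro Max_in) auto
  then obtain a where a: "a \<in> A" "card (F a) = m" by auto
  have "I \<subseteq> (\<Union>a\<in>A. F a)" using c by (auto simp: F_def)
  then have "card I \<le> card (\<Union>a\<in>A. F a)" using fin fin_A by (intro card_mono) (auto simp: F_def)
  also have "\<dots> \<le> (\<Sum>a\<in>A. card (F a))" by (rule card_UN_le[OF fin_A])
  also have "\<dots> \<le> card A * m"
    using sum_bounded_above[of A "\<lambda>a. card (F a)" m] fin_A by (simp add: m_def)
  finally have pigeon: "card I \<le> card A * card (F a)" using a by simp
  have "F a \<noteq> {}"
  proof
    assume "F a = {}"
    then have "card I = 0" using pigeon by simp
    then show False using False fin by simp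
  qed
  then obtain y0 where y0: "y0 \<in> F a" by blast
  have F_I: "F a \<subseteq> I" by (auto simp: F_def)
  have y0_I: "y0 \<in> I" using y0 F_I by blast
  have T_diff: "norm (T (y - y')) \<le> 1" if "y \<in> F a" "y' \<in> F a" for y y'
  proof -
    have "norm (T y - a) \<le> 1/2" "norm (T y' - a) \<le> 1/2"
      using that c(2)[of y] c(2)[of y'] by (auto simp: F_def)
    then show ?thesis
      using norm_triangle_ineq4[of "T y - a" "T y' - a"] by (simp add: linear_diff[OF lin(2)])
  qed

  define w where "w y = \<pi> (y - y0) - (y - y0)" for y
  define X where "X = {x \<in> Rn n. norm x \<le> 1 \<and> (\<exists>l e. l \<in> L \<and> e \<in> E \<and> norm e \<le> 3 * R \<and> x = 2 *\<^sub>R l + e)}"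
  have XI: "x \<in> X" if "x \<in> Rn n" "norm x \<le> 1" "l \<in> L" "e \<in> E" "norm e \<le> 3 * R" "x = 2 *\<^sub>R l + e" for x l e
    using that by (auto simp: X_def)
  have E0: "0 \<in> E" using E by (simp add: subspace_0)
  have X_convex: "convex X"
  proof (rule convexI)
    fix x x' :: finseq and u v :: real
    assume xx: "x \<in> X" "x' \<in> X" and uv: "0 \<le> u" "0 \<le> v" "u + v = 1"
    from xx obtain l e l' e' where x: "x \<in> Rn n" "norm x \<le> 1" "l \<in> L" "e \<in> E" "norm e \<le> 3 * R" "x = 2 *\<^sub>R l + e"
      and x': "x' \<in> Rn n" "norm x' \<le> 1" "l' \<in> L" "e' \<in> E" "norm e' \<le> 3 * R" "x' = 2 *\<^sub>R l' + e'"
      by (auto simp: X_def)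
    have "u *\<^sub>R x + v *\<^sub>R x' \<in> Rn n \<inter> cball 0 1"
      using x x' uv by (intro convexD convex_Int convex_cball subspace_imp_convex subspace_Rn) auto
    moreover have "u *\<^sub>R l + v *\<^sub>R l' \<in> L" using L x x' uv by (intro convexD) auto
    moreover have "u *\<^sub>R e + v *\<^sub>R e' \<in> E \<inter> cball 0 (3 * R)"
      using E x x' uv by (intro convexD convex_Int convex_cball subspace_imp_convex) auto
    moreover have "u *\<^sub>R x + v *\<^sub>R x' = 2 *\<^sub>R (u *\<^sub>R l + v *\<^sub>R l') + (u *\<^sub>R e + v *\<^sub>R e')"
      by (simp add: x(6) x'(6) algebra_simps)
    ultimately show "u *\<^sub>R x + v *\<^sub>R x' \<in> X" by (intro XI) auto
  qed
  have X_sym: "- x \<in> X" if "x \<in> X" for x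
  proof -
    from that obtain l e where x: "x \<in> Rn n" "norm x \<le> 1" "l \<in> L" "e \<in> E" "norm e \<le> 3 * R" "x = 2 *\<^sub>R l + e"
      by (auto simp: X_def)
    have eq: "- x = 2 *\<^sub>R (- l) + (- e)" by (simp add: x(6))
    show ?thesis
      by (rule XI[OF Rn_closed(3)[OF x(1)] _ L(3)[OF x(3)] subspace_neg[OF E(1) x(4)] _ eq])
        (use x(2,5) in simp_all)
  qed
  have X_ball: "x \<in> X" if "x \<in> Rn n" "norm x < min 1 \<eta>" for x
  proof (rule XI[of x "(1/2) *\<^sub>R x" 0])
    show "(1/2) *\<^sub>R x \<in> L" by (rule \<eta>(1)) (use that \<eta>(2) in auto)
  qed (use that E0 R in auto)
  have w_X: "w y \<in> X" if y: "y \<in> F a" for y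
  proof (rule XI[of "w y" "(1/2) *\<^sub>R y0 + (-1/2) *\<^sub>R y" "\<pi> (y - y0)"])
    have y_I: "y \<in> I" using y F_I by blast
    have d: "y - y0 \<in> Rn n" using I_Rn[OF y_I] I_Rn[OF y0_I] by auto
    have \<pi>_Rn: "\<pi> (y - y0) \<in> Rn n" using \<pi>_E E by blast
    show "w y \<in> Rn n" unfolding w_def using d \<pi>_Rn by (rule Rn_closed(2)[rotated])
    show "norm (w y) \<le> 1"
      using T_diff[OF y y0] T_norm[OF d] by (simp add: w_def norm_minus_commute)
    show "(1/2) *\<^sub>R y0 + (-1/2) *\<^sub>R y \<in> L"
      using I_L y_I y0_I by (intro abs_convex) auto
    show "\<pi> (y - y0) \<in> E" by (rule \<pi>_E)
    have "norm (\<pi> (y - y0)) \<le> norm y + norm y0"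
      using \<pi>_norm[OF d] norm_triangle_ineq4[of y y0] by simp
    then show "norm (\<pi> (y - y0)) \<le> 3 * R" using I(3)[OF y_I] I(3)[OF y0_I] R by simp
    show "w y = 2 *\<^sub>R ((1/2) *\<^sub>R y0 + (-1/2) *\<^sub>R y) + \<pi> (y - y0)"
      by (simp add: w_def algebra_simps)
  qed
  have y_X: "(1/R) *\<^sub>R y \<in> X" if y: "y \<in> I" for y
  proof (rule XI[of _ "(1/(2*R)) *\<^sub>R y" 0])
    show "(1/R) *\<^sub>R y \<in> Rn n" using I_Rn[OF y] by auto
    show "norm ((1/R) *\<^sub>R y) \<le> 1" using I(3)[OF y] R by (simp add: divide_simps)
    show "(1/(2*R)) *\<^sub>R y \<in> L" by (rule shrink[OF I_L[OF y]]) (use R in auto)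
  qed (use E0 R in auto)

  define z where "z = (\<lambda>(y1, y). w y1 + (1/R) *\<^sub>R y)"
  have z_sep: "z p - z q \<notin> (*\<^sub>R) (1/R) ` X" if pq: "p \<in> F a \<times> I" "q \<in> F a \<times> I" "p \<noteq> q" for p q
  proof
    obtain y1 y y1' y' where p: "p = (y1, y)" and q: "q = (y1', y')" by (cases p, cases q)
    have mem: "y1 \<in> F a" "y1' \<in> F a" "y \<in> I" "y' \<in> I" using pq p q by auto
    have mem1: "y1 \<in> I" "y1' \<in> I" using mem F_I by auto
    assume "z p - z q \<in> (*\<^sub>R) (1/R) ` X"
    then obtain u where u: "u \<in> X" "z p - z q = (1/R) *\<^sub>R u" by auto
    then have eq: "w y1 - w y1' = (1/R) *\<^sub>R (u - (y - y'))"
      by (simp add: z_def p q algebra_simps)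
    show False
    proof (cases "y1 = y1'")
      case True
      then have "u = y - y'" using eq R by simp
      moreover have "norm u \<le> 1" using u by (simp add: X_def)
      moreover have "y \<noteq> y'" using pq(3) True p q by simp
      ultimately show False using I_sep[OF mem(3,4)] by simp
    next
      case False
      obtain l e where l: "l \<in> L" and e: "e \<in> E" "norm e \<le> 3 * R" and u_eq: "u = 2 *\<^sub>R l + e"
        using u(1) by (auto simp: X_def)
      define d where "d = y1 - y1'"
      have d_Rn: "d \<in> Rn n" unfolding d_def using I_Rn mem1 by auto
      have w_diff: "w y1 - w y1' = \<pi> d - d"
        by (simp add: w_def d_def linear_diff[OF lin(1)])
      define v where "v = \<pi> d - (1/R) *\<^sub>R e"
      have "v \<in> E" unfolding v_def using \<pi>_E e E by (intro subspace_diff subspace_scale) auto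
      define g where "g = (1/2) *\<^sub>R y1 + (-1/2) *\<^sub>R y1'"
      define h where "h = (1/2) *\<^sub>R l + (1/2) *\<^sub>R ((-1/2) *\<^sub>R y + (1/2) *\<^sub>R y')"
      have "g \<in> L" "h \<in> L"
        unfolding g_def h_def by (intro abs_convex I_L mem mem1 l; simp)+
      have "v = d + (1/R) *\<^sub>R (2 *\<^sub>R l - (y - y'))"
        using eq w_diff by (simp add: v_def u_eq algebra_simps)
      also have "\<dots> = 2 *\<^sub>R g + (4/R) *\<^sub>R h"
        by (simp add: g_def h_def d_def algebra_simps)
      \<comment> \<open>the coefficients \<open>1/3\<close> and \<open>2/(3 R)\<close> add up to at most \<open>1\<close>\<close>
      finally have v_eq: "(1/6) *\<^sub>R v = (1/3) *\<^sub>R g + (2/(3*R)) *\<^sub>R h"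
        by (simp add: scaleR_add_right)
      have "(1/6) *\<^sub>R v \<in> L"
        unfolding v_eq using \<open>g \<in> L\<close> \<open>h \<in> L\<close> R by (intro abs_convex) (auto simp: divide_simps)
      moreover have "(1/6) *\<^sub>R v \<in> E" using \<open>v \<in> E\<close> E by (simp add: subspace_scale)
      ultimately have "norm v \<le> 6" using bdd[of "(1/6) *\<^sub>R v"] by simp
      moreover have "norm ((1/R) *\<^sub>R e) \<le> 3" using e R by (simp add: divide_simps)
      moreover have "norm (\<pi> d) \<le> norm v + norm ((1/R) *\<^sub>R e)"
        using norm_triangle_ineq[of v "(1/R) *\<^sub>R e"] by (simp add: v_def)
      moreover have "norm (d - \<pi> d) \<le> 1"
        using T_diff[OF mem(1,2)] T_norm[OF d_Rn] by (simp add: d_def)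
      moreover have "norm d \<le> norm (\<pi> d) + norm (d - \<pi> d)"
        using norm_triangle_ineq[of "\<pi> d" "d - \<pi> d"] by simp
      ultimately show False using I_sep[OF mem1 False] by (simp add: d_def)
    qed
  qed
  have inj: "inj_on z (F a \<times> I)"
  proof (rule inj_onI, rule ccontr)
    fix p q assume "p \<in> F a \<times> I" "q \<in> F a \<times> I" "z p = z q" "p \<noteq> q"
    then have "0 \<notin> (*\<^sub>R) (1/R) ` X" using z_sep[of p q] by simp
    moreover have "0 \<in> X" using X_ball[of 0] \<eta>(2) Rn_closed(5) by simp
    ultimately show False by (auto simp: image_iff)
  qed
  have "real (card (z ` (F a \<times> I))) * (1/R) ^ n \<le> (4 * 2 + 2 * (1/R)) ^ n"
  proof (rule packing_bound[where X = X and \<rho> = 1 and \<eta> = "min 1 \<eta>"])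
    show "X \<subseteq> Rn n" by (auto simp: X_def)
    show "norm x \<le> 1" if "x \<in> X" for x using that by (simp add: X_def)
    show "finite (z ` (F a \<times> I))" using fin F_I by (auto intro: finite_subset)
    show "z ` (F a \<times> I) \<subseteq> (*\<^sub>R) 2 ` X"
    proof (rule image_subsetI)
      fix p assume "p \<in> F a \<times> I"
      then obtain y1 y where p: "p = (y1, y)" "y1 \<in> F a" "y \<in> I" by auto
      have "(1/2) *\<^sub>R w y1 + (1/2) *\<^sub>R ((1/R) *\<^sub>R y) \<in> X"
        by (rule convexD[OF X_convex w_X[OF p(2)] y_X[OF p(3)]]) auto
      moreover have "z p = 2 *\<^sub>R ((1/2) *\<^sub>R w y1 + (1/2) *\<^sub>R ((1/R) *\<^sub>R y))"
        by (simp add: z_def p scaleR_add_right)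
      ultimately show "z p \<in> (*\<^sub>R) 2 ` X" by blast
    qed
    show "x - x' \<notin> (*\<^sub>R) (1/R) ` X"
      if "x \<in> z ` (F a \<times> I)" "x' \<in> z ` (F a \<times> I)" "x \<noteq> x'" for x x'
      using that z_sep by blast
  qed (use X_convex X_sym X_ball \<eta> R in auto)
  also have "\<dots> \<le> 10 ^ n" using R by (intro power_mono) (auto simp: divide_simps)
  finally have "real (card (F a \<times> I)) * (1/R) ^ n * R ^ n \<le> 10 ^ n * R ^ n"
    using R by (intro mult_right_mono) (auto simp: card_image[OF inj])
  then have prod: "real (card (F a)) * real (card I) \<le> (10 * R) ^ n"
    using R by (simp add: card_cartesian_product power_divide power_mult_distrib)
  have "(real (card I))\<^sup>2 \<le> (real (card A) * real (card (F a))) * real (card I)"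
    unfolding power2_eq_square using pigeon
    by (intro mult_right_mono) (simp_all flip: of_nat_mult)
  also have "\<dots> \<le> (10 * R) ^ (n - k) * (10 * R) ^ n"
    unfolding mult.assoc using card_A[OF A] prod R by (intro mult_mono) auto
  finally show ?thesis .
qed

lemma separated_in_symmetric_body:
  assumes L: "L \<subseteq> Rn n" "convex L" "\<And>x. x \<in> L \<Longrightarrow> - x \<in> L"
    and E: "subspace E" "E \<subseteq> Rn n" "dim E = k"
    and bdd: "\<And>x. x \<in> L \<Longrightarrow> x \<in> E \<Longrightarrow> norm x \<le> 1 / 2"
    and R: "1 \<le> R" and I: "separated 12 I" "I \<subseteq> L" "\<And>y. y \<in> I \<Longrightarrow> norm y \<le> R"
  shows "(real (card I))\<^sup>2 \<le> (10 * R) ^ (n - k) * (10 * R) ^ n"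
proof (cases "L = {}")
  case True
  then show ?thesis using I R by simp
next
  case False
  then obtain x where x: "x \<in> L" by blast
  have "0 \<in> L"
    using symmetric_convex_abs_combination[OF L(2,3) x x, of 0 0] by simp
  obtain L' \<eta> where L': "L \<subseteq> L'" "L' \<subseteq> Rn n" "convex L'" "\<And>x. x \<in> L' \<Longrightarrow> - x \<in> L'"
    and \<eta>: "\<And>x. x \<in> Rn n \<Longrightarrow> norm x < \<eta> \<Longrightarrow> x \<in> L'" "0 < \<eta>"
    and bdd': "\<And>x. x \<in> L' \<Longrightarrow> x \<in> E \<Longrightarrow> norm x \<le> 1"
    using fatten_symmetric_convex[OF L \<open>0 \<in> L\<close> E(1,2) bdd] by metis
  show ?thesis
    by (rule separated_in_fat_body[OF L'(2-4) \<eta> E bdd' R I(1) order_trans[OF I(2) L'(1)] I(3)])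
qed

section \<open>Measurability on the orthogonal group\<close>

lemma orth_groupD:
  assumes "U \<in> orth_group n"
  shows "linear U" "norm (U x) = norm x" "x \<in> Rn n \<Longrightarrow> U x \<in> Rn n"
  using assms orth_group_Rn[OF assms]
  by (auto simp: orth_group_def orthogonal_transformation_norm orthogonal_transformation_linear)

lemma space_borel_orth: "space (borel_orth n) = orth_group n"
  by (simp add: borel_orth_def)

lemma matrix_entry_measurable:
  assumes "i < n" "j < n"
  shows "(\<lambda>U. inner (unit_seq i) (U (unit_seq j))) \<in> borel_measurable (borel_orth n)"
proof -
  have "matrix_entries n \<in> borel_orth n \<rightarrow>\<^sub>M Pi\<^sub>M ({..<n} \<times> {..<n}) (\<lambda>_. borel)"
    unfolding borel_orth_def
    by (rule measurable_vimage_algebra1) (auto simp: matrix_entries_def space_PiM)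
  then have "(\<lambda>U. matrix_entries n U (i, j)) \<in> borel_measurable (borel_orth n)"
    using assms by (intro measurable_component_singleton[THEN measurable_compose_rev, of "(i, j)"]) auto
  then show ?thesis using assms by (simp add: matrix_entries_def)
qed

lemma coord_linear_image:
  assumes "linear U" "x \<in> Rn n"
  shows "coord (U x) i = (\<Sum>j<n. coord x j * inner (unit_seq i) (U (unit_seq j)))"
proof -
  have "U x = (\<Sum>j<n. coord x j *\<^sub>R U (unit_seq j))"
    using arg_cong[OF Rn_eq_sum[OF assms(2)], of U] assms(1)
    by (simp add: linear_sum linear_cmul o_def)
  then show ?thesis by (simp add: coord_sum inner_unit_seq)
qed

lemma coord_image_measurable:
  assumes "i < n" "x \<in> Rn n"
  shows "(\<lambda>U. coord (U x) i) \<in> borel_measurable (borel_orth n)"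
proof -
  have "(\<lambda>U. \<Sum>j<n. coord x j * inner (unit_seq i) (U (unit_seq j))) \<in> borel_measurable (borel_orth n)"
    using matrix_entry_measurable assms by (intro borel_measurable_sum borel_measurable_times) auto
  then show ?thesis
    by (rule measurable_cong[THEN iffD1, rotated])
      (simp add: coord_linear_image[OF orth_groupD(1) assms(2)] space_borel_orth)
qed

lemma norm_image_diff_sets:
  assumes x: "x \<in> Rn n" and q: "q \<in> Rn n"
  shows "{U \<in> orth_group n. norm (U x - q) < r} \<in> sets (borel_orth n)"
proof -
  have "(\<lambda>U. sqrt (\<Sum>i<n. (coord (U x) i - coord q i)\<^sup>2)) \<in> borel_measurable (borel_orth n)"
    using coord_image_measurable[OF _ x] by measurable
  then have "{U \<in> space (borel_orth n). sqrt (\<Sum>i<n. (coord (U x) i - coord q i)\<^sup>2) < r} \<in> sets (borel_orth n)"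
    by measurable
  also have "{U \<in> space (borel_orth n). sqrt (\<Sum>i<n. (coord (U x) i - coord q i)\<^sup>2) < r}
      = {U \<in> orth_group n. norm (U x - q) < r}"
  proof -
    have "norm (U x - q) = sqrt (\<Sum>i<n. (coord (U x) i - coord q i)\<^sup>2)" if "U \<in> orth_group n" for U
      by (subst norm_Rn[OF Rn_closed(2)[OF orth_groupD(3)[OF that x] q]]) simp
    then show ?thesis by (auto simp: space_borel_orth)
  qed
  finally show ?thesis .
qed

lemma image_in_interior_sets:
  assumes x: "x \<in> Rn n"
  shows "{U \<in> orth_group n. U x \<in> Rn_interior n K} \<in> sets (borel_orth n)"
proof -
  obtain I :: "(finseq \<times> nat) set" where I: "countable I" "I \<subseteq> Rn n \<times> UNIV"
    "Rn_interior n K = (\<Union>(q, m)\<in>I. {x \<in> Rn n. norm (x - q) < 1 / real (Suc m)})"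
    by (rule Rn_interior_eq_countable_Union)
  have "{U \<in> orth_group n. U x \<in> Rn_interior n K}
      = (\<Union>(q, m)\<in>I. {U \<in> orth_group n. norm (U x - q) < 1 / real (Suc m)})"
    unfolding I(3) using orth_groupD(3)[OF _ x] by auto
  also have "\<dots> \<in> sets (borel_orth n)"
    using I(1,2) x by (intro sets.countable_UN'') (auto intro: norm_image_diff_sets)
  finally show ?thesis .
qed

lemma comp_in_orth_group: "V \<in> orth_group n \<Longrightarrow> U \<in> orth_group n \<Longrightarrow> V \<circ> U \<in> orth_group n"
  by (auto simp: orth_group_def intro: orthogonal_transformation_compose)

lemma left_translation_measurable:
  assumes V: "V \<in> orth_group n"
  shows "(\<lambda>U. V \<circ> U) \<in> borel_orth n \<rightarrow>\<^sub>M borel_orth n"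
proof -
  have "(\<lambda>U. matrix_entries n (V \<circ> U)) \<in> borel_orth n \<rightarrow>\<^sub>M Pi\<^sub>M ({..<n} \<times> {..<n}) (\<lambda>_. borel)"
    unfolding matrix_entries_def
  proof (rule measurable_restrict)
    fix p assume "p \<in> {..<n} \<times> {..<n}"
    then obtain i j where p: "p = (i, j)" "i < n" "j < n" by auto
    have u: "unit_seq j \<in> Rn n" using p by (auto simp: Rn_def coord_unit_seq)
    have "(\<lambda>U. \<Sum>m<n. coord (U (unit_seq j)) m * inner (unit_seq i) (V (unit_seq m))) \<in> borel_measurable (borel_orth n)"
      using coord_image_measurable[OF _ u] by (intro borel_measurable_sum borel_measurable_times) auto
    then show "(\<lambda>U. case p of (i, j) \<Rightarrow> inner (unit_seq i) ((V \<circ> U) (unit_seq j))) \<in> borel_measurable (borel_orth n)"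
    proof (rule measurable_cong[THEN iffD1, rotated])
      fix U assume "U \<in> space (borel_orth n)"
      then have "U (unit_seq j) \<in> Rn n" using orth_groupD(3)[OF _ u] by (simp add: space_borel_orth)
      from coord_linear_image[OF orth_groupD(1)[OF V] this, of i]
      show "(\<Sum>m<n. coord (U (unit_seq j)) m * inner (unit_seq i) (V (unit_seq m)))
          = (case p of (i, j) \<Rightarrow> inner (unit_seq i) ((V \<circ> U) (unit_seq j)))"
        by (simp add: p inner_unit_seq)
    qed
  qed
  then show ?thesis
    unfolding borel_orth_def
    by (intro measurable_vimage_algebra2)
      (use comp_in_orth_group[OF V] in \<open>auto simp: borel_orth_def[symmetric] space_borel_orth\<close>)
qed

text \<open>
  The reflection in the hyperplane orthogonal to \<open>x - y\<close> exchanges \<open>x\<close> and \<open>y\<close>.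
\<close>

lemma orth_group_transitive:
  assumes x: "x \<in> Rn n" and y: "y \<in> Rn n" and eq: "norm x = norm y"
  obtains V where "V \<in> orth_group n" "V x = y"
proof (cases "x = y")
  case True
  then show thesis by (intro that[of id]) (auto simp: orth_group_def orthogonal_transformation_id id_def)
next
  case False
  define a where "a = x - y"
  define c where "c = 2 / inner a a"
  define V where "V z = z - (c * inner z a) *\<^sub>R a" for z
  have a: "a \<in> Rn n" "inner a a \<noteq> 0" using x y False by (auto simp: a_def)
  have lin: "linear V"
    by (rule linearI) (auto simp: V_def inner_add_left algebra_simps)
  have c: "c * inner a a = 2" using a by (simp add: c_def)
  have "inner (V z) (V w) = inner z w" for z w
  proof -
    have "inner (V z) (V w) = inner z w - 2 * c * inner z a * inner w a
        + (c * inner a a) * c * inner z a * inner w a"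
      by (simp add: V_def inner_diff_left inner_diff_right inner_commute algebra_simps)
    then show ?thesis by (simp add: c)
  qed
  then have "orthogonal_transformation V" using lin by (simp add: orthogonal_transformation_def)
  moreover have "V (unit_seq i) = unit_seq i" if "i \<ge> n" for i
    using a that by (simp add: V_def inner_unit_seq Rn_def)
  moreover have "V x = y"
  proof -
    have "inner x x = inner y y" using eq by (simp add: norm_eq)
    then have "inner a a = 2 * inner x a"
      by (simp add: a_def inner_diff_left inner_diff_right inner_commute)
    then have "c * inner x a = 1" using c by simp
    then show ?thesis by (simp add: V_def a_def)
  qed
  ultimately show thesis by (intro that[of V]) (auto simp: orth_group_def)
qed

section \<open>The probability that a random image of the body comes close to a given point\<close>

text \<open>
  The radius \<open>3\<close> leaves room for passing to the points of a net of mesh \<open>2\<close>. The strict inequality makes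
  the event open in \<open>U\<close>, hence measurable for every \<open>L\<close>.
\<close>

definition near_event :: "nat \<Rightarrow> finseq set \<Rightarrow> finseq \<Rightarrow> (finseq \<Rightarrow> finseq) set"
  where "near_event n L x = {U \<in> orth_group n. \<exists>l\<in>L. norm (U l - x) < 3}"

lemma near_event_sets:
  assumes L: "L \<subseteq> Rn n" and x: "x \<in> Rn n"
  shows "near_event n L x \<in> sets (borel_orth n)"
proof -
  obtain D where D: "countable D" "D \<subseteq> L" "\<And>l e. l \<in> L \<Longrightarrow> 0 < e \<Longrightarrow> \<exists>s\<in>D. norm (l - s) < e"
    using countable_dense_subset[OF L] by blast
  have "near_event n L x = (\<Union>l\<in>D. {U \<in> orth_group n. norm (U l - x) < 3})"
  proof (intro equalityI subsetI)
    fix U assume "U \<in> near_event n L x"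
    then obtain l where U: "U \<in> orth_group n" and l: "l \<in> L" "norm (U l - x) < 3"
      by (auto simp: near_event_def)
    obtain s where s: "s \<in> D" "norm (l - s) < 3 - norm (U l - x)"
      using D(3)[OF l(1), of "3 - norm (U l - x)"] l by auto
    have "norm (U s - x) \<le> norm (U l - x) + norm (U (l - s))"
      using norm_triangle_ineq4[of "U l - x" "U (l - s)"]
      by (simp add: linear_diff[OF orth_groupD(1)[OF U]])
    then have "norm (U s - x) < 3" using s by (simp add: orth_groupD(2)[OF U])
    then show "U \<in> (\<Union>l\<in>D. {U \<in> orth_group n. norm (U l - x) < 3})" using U s by blast
  qed (use D in \<open>auto simp: near_event_def\<close>)
  also have "\<dots> \<in> sets (borel_orth n)"
    using D L x by (intro sets.countable_UN'' norm_image_diff_sets) auto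
  finally show ?thesis .
qed

text \<open>
  If \<open>V\<close> maps \<open>x\<close> to \<open>y\<close>, then \<open>U L\<close> is close to \<open>x\<close> iff \<open>V U L\<close> is close to \<open>y\<close>, and \<open>V U\<close> has
  the same distribution as \<open>U\<close>.
\<close>

lemma near_event_invariant:
  assumes haar: "normalized_haar n \<mu>" and L: "L \<subseteq> Rn n"
    and x: "x \<in> Rn n" and y: "y \<in> Rn n" and eq: "norm x = norm y"
  shows "measure \<mu> (near_event n L x) = measure \<mu> (near_event n L y)"
proof -
  obtain V where V: "V \<in> orth_group n" "V x = y" using orth_group_transitive[OF x y eq] .
  have sets: "sets \<mu> = sets (borel_orth n)" and inv: "distr \<mu> \<mu> (\<lambda>U. V \<circ> U) = \<mu>"
    using haar V by (auto simp: normalized_haar_def)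
  have space: "space \<mu> = orth_group n"
    using sets_eq_imp_space_eq[OF sets] by (simp add: space_borel_orth)
  have meas: "(\<lambda>U. V \<circ> U) \<in> \<mu> \<rightarrow>\<^sub>M \<mu>"
    using left_translation_measurable[OF V(1)] by (simp cong: measurable_cong_sets add: sets)
  have "norm (V (U l) - y) = norm (U l - x)" for U :: "finseq \<Rightarrow> finseq" and l
  proof -
    have "V (U l) - y = V (U l - x)" by (simp add: V(2)[symmetric] linear_diff[OF orth_groupD(1)[OF V(1)]])
    then show ?thesis by (simp add: orth_groupD(2)[OF V(1)])
  qed
  then have pre: "(\<lambda>U. V \<circ> U) -` near_event n L y \<inter> space \<mu> = near_event n L x"
    using comp_in_orth_group[OF V(1)] by (auto simp: near_event_def space)
  have "measure \<mu> (near_event n L y) = measure (distr \<mu> \<mu> (\<lambda>U. V \<circ> U)) (near_event n L y)"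
    by (simp add: inv)
  also have "\<dots> = measure \<mu> (near_event n L x)"
    using near_event_sets[OF L y] by (subst measure_distr[OF meas]) (auto simp: sets pre)
  finally show ?thesis by simp
qed

lemma near_event_shrink:
  assumes L: "\<And>l s. l \<in> L \<Longrightarrow> 0 \<le> s \<Longrightarrow> s \<le> 1 \<Longrightarrow> s *\<^sub>R l \<in> L" and s: "0 \<le> s" "s \<le> 1"
  shows "near_event n L x \<subseteq> near_event n L (s *\<^sub>R x)"
proof
  fix U assume "U \<in> near_event n L x"
  then obtain l where U: "U \<in> orth_group n" and l: "l \<in> L" "norm (U l - x) < 3"
    by (auto simp: near_event_def)
  have "U (s *\<^sub>R l) - s *\<^sub>R x = s *\<^sub>R (U l - x)"
    by (simp add: linear_cmul[OF orth_groupD(1)[OF U]] algebra_simps)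
  then have "norm (U (s *\<^sub>R l) - s *\<^sub>R x) \<le> norm (U l - x)"
    using s by (simp add: mult_left_le_one_le)
  then show "U \<in> near_event n L (s *\<^sub>R x)"
    using U l L s by (auto simp: near_event_def intro!: bexI[of _ "s *\<^sub>R l"])
qed

lemma (in prob_space) sum_prob_le_multiplicity:
  assumes Y: "finite Y" "\<And>y. y \<in> Y \<Longrightarrow> G y \<in> events"
    and mult: "\<And>U. U \<in> space M \<Longrightarrow> real (card {y \<in> Y. U \<in> G y}) \<le> N"
  shows "(\<Sum>y\<in>Y. prob (G y)) \<le> N"
proof -
  have int: "integrable M (indicator (G y) :: _ \<Rightarrow> real)" if "y \<in> Y" for y
    using Y(2)[OF that] by (simp add: emeasure_eq_measure)
  have "(\<Sum>y\<in>Y. prob (G y)) = (\<Sum>y\<in>Y. \<integral>U. indicator (G y) U \<partial>M)"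
    using Y by (intro sum.cong) (auto simp: Int_absorb2 sets.sets_into_space)
  also have "\<dots> = (\<integral>U. (\<Sum>y\<in>Y. indicator (G y) U) \<partial>M)"
    using int by (subst Bochner_Integration.integral_sum) auto
  also have "\<dots> \<le> N"
  proof (rule integral_le_const)
    show "integrable M (\<lambda>U. \<Sum>y\<in>Y. indicator (G y) U :: real)" using int by auto
    have "(\<Sum>y\<in>Y. indicator (G y) U :: real) = real (card {y \<in> Y. U \<in> G y})" for U
      using Y(1) by (simp add: indicator_def sum.If_cases Int_def)
    then show "AE U in M. (\<Sum>y\<in>Y. indicator (G y) U) \<le> N" using mult by auto
  qed
  finally show ?thesis .
qed

text \<open>
  Take a maximal \<open>18\<close>-separated set \<open>Y\<close> in the ball of radius \<open>R\<close>; it has at least \<open>(R/18)\<^sup>n\<close> points. For one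
  fixed \<open>U\<close>, points of \<open>Y\<close> that are within \<open>3\<close> of \<open>U L\<close> are near points of \<open>U L\<close> that are more than
  \<open>18 - 2 \<cdot> 3 = 12\<close> apart, and \<open>separated_in_symmetric_body\<close> bounds their number by a multiple of
  \<open>R\<^sup>n\<close> divided by \<open>R\<close> to the power \<open>k/2\<close>. Taking expectations bounds the sum over \<open>Y\<close> of the probabilities. Each
  of them is at least the one for \<open>x\<close>, because the event for \<open>x\<close> is contained in those for its
  multiples by factors in \<open>[0, 1]\<close>, and only the norm of a point matters. The statement is squared to avoid
  the root of \<open>R\<^sup>k\<close>.
\<close>

lemma near_event_probability:
  assumes haar: "normalized_haar n \<mu>"
    and L: "L \<subseteq> Rn n" "convex L" "\<And>x. x \<in> L \<Longrightarrow> - x \<in> L"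
    and E: "subspace E" "E \<subseteq> Rn n" "dim E = k" and k: "k \<le> n"
    and bdd: "\<And>x. x \<in> L \<Longrightarrow> x \<in> E \<Longrightarrow> norm x \<le> 1 / 2"
    and x: "x \<in> Rn n" "norm x = R" and R: "1 \<le> R"
  shows "(measure \<mu> (near_event n L x))\<^sup>2 * R ^ k \<le> (720\<^sup>2) ^ n"
proof -
  have sets: "sets \<mu> = sets (borel_orth n)" using haar by (auto simp: normalized_haar_def)
  interpret prob_space \<mu> using haar by (simp add: normalized_haar_def)
  have space: "space \<mu> = orth_group n"
    using sets_eq_imp_space_eq[OF sets] by (simp add: space_borel_orth)
  define p where "p = measure \<mu> (near_event n L x)"
  define B where "B = {y \<in> Rn n. norm y \<le> R}"
  have "real (card Y) \<le> (4 * R + 2 * 18) ^ n" if Y: "Y \<subseteq> B" "separated 18 Y" for Y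
  proof -
    have "real (card Y) * 18 ^ n \<le> (4 * R + 2 * 18) ^ n"
      by (rule norm_ball_packing) (use Y R in \<open>auto simp: B_def\<close>)
    moreover have "real (card Y) * 1 \<le> real (card Y) * 18 ^ n"
      by (intro mult_left_mono) auto
    ultimately show ?thesis by simp
  qed
  then obtain Y where Y: "Y \<subseteq> B" "separated 18 Y"
    and net: "\<And>y. y \<in> B \<Longrightarrow> \<exists>y'\<in>Y. norm (y - y') \<le> 18"
    using maximal_separated_subset[of B 18] by (metis zero_le_numeral)
  have fin: "finite Y" using Y by (simp add: separated_def)
  have card_Y: "R ^ n \<le> real (card Y) * 18 ^ n"
    by (rule covering_bound) (use R Y fin net in \<open>auto simp: B_def\<close>)
  have Y_Rn: "y \<in> Rn n" and Y_norm: "norm y \<le> R" if "y \<in> Y" for y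
    using Y that by (auto simp: B_def)
  have star: "s *\<^sub>R l \<in> L" if "l \<in> L" "0 \<le> s" "s \<le> 1" for l s
    using symmetric_convex_abs_combination[OF L(2,3) that(1) that(1), of s 0] that by simp
  have p_le: "p \<le> measure \<mu> (near_event n L y)" if y: "y \<in> Y" for y
  proof -
    define x' where "x' = (norm y / R) *\<^sub>R x"
    have "x' \<in> Rn n" "norm x' = norm y" using x R by (auto simp: x'_def)
    have "p \<le> measure \<mu> (near_event n L x')"
      unfolding p_def x'_def
    proof (rule finite_measure_mono)
      show "near_event n L x \<subseteq> near_event n L ((norm y / R) *\<^sub>R x)"
        by (rule near_event_shrink[OF star]) (use R Y_norm[OF y] in auto)
      show "near_event n L ((norm y / R) *\<^sub>R x) \<in> sets \<mu>"
        using near_event_sets[OF L(1)] x by (auto simp: sets)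
    qed
    also have "\<dots> = measure \<mu> (near_event n L y)"
      by (rule near_event_invariant[OF haar L(1) \<open>x' \<in> Rn n\<close> Y_Rn[OF y] \<open>norm x' = norm y\<close>])
    finally show ?thesis .
  qed
  define Q where "Q = (10 * (R + 3)) ^ (n - k) * (10 * (R + 3)) ^ n"
  have "real (card {y \<in> Y. U \<in> near_event n L y}) \<le> sqrt Q" if U: "U \<in> space \<mu>" for U
  proof -
    let ?S = "{y \<in> Y. U \<in> near_event n L y}"
    have U_orth: "U \<in> orth_group n" using U space by simp
    have "\<forall>y\<in>?S. \<exists>l\<in>L. norm (U l - y) < 3" by (auto simp: near_event_def)
    then obtain l where l: "\<And>y. y \<in> ?S \<Longrightarrow> l y \<in> L" "\<And>y. y \<in> ?S \<Longrightarrow> norm (U (l y) - y) < 3"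
      by metis
    have far: "12 < norm (l y - l y')" if y: "y \<in> ?S" "y' \<in> ?S" "y \<noteq> y'" for y y'
    proof -
      have "18 < norm (y - y')" using Y(2) y unfolding separated_def by blast
      moreover have "y - y' = U (l y - l y') - (U (l y) - y) + (U (l y') - y')"
        by (simp add: linear_diff[OF orth_groupD(1)[OF U_orth]])
      then have "norm (y - y') \<le> norm (U (l y - l y')) + norm (U (l y) - y) + norm (U (l y') - y')"
        by (metis norm_triangle_le norm_triangle_ineq4 add_mono order_refl)
      ultimately show ?thesis
        using l(2)[OF y(1)] l(2)[OF y(2)] by (simp add: orth_groupD(2)[OF U_orth])
    qed
    have inj: "inj_on l ?S"
    proof (rule inj_onI, rule ccontr)
      fix y y' assume "y \<in> ?S" "y' \<in> ?S" "l y = l y'" "y \<noteq> y'"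
      then show False using far[of y y'] by simp
    qed
    have "(real (card (l ` ?S)))\<^sup>2 \<le> Q"
      unfolding Q_def
    proof (rule separated_in_symmetric_body[OF L E bdd])
      show "separated 12 (l ` ?S)"
        unfolding separated_def using fin far by auto
      show "l ` ?S \<subseteq> L" using l(1) by blast
      show "norm z \<le> R + 3" if z: "z \<in> l ` ?S" for z
      proof -
        obtain y where y: "y \<in> ?S" "z = l y" using z by blast
        have "norm (U (l y)) \<le> norm (U (l y) - y) + norm y"
          using norm_triangle_ineq[of "U (l y) - y" y] by simp
        then show ?thesis
          using l(2)[OF y(1)] Y_norm[of y] y by (simp add: orth_groupD(2)[OF U_orth])
      qed
    qed (use R in auto)
    then show ?thesis by (simp add: card_image[OF inj] real_le_rsqrt)
  qed
  then have "(\<Sum>y\<in>Y. prob (near_event n L y)) \<le> sqrt Q"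
    using fin near_event_sets[OF L(1) Y_Rn] by (intro sum_prob_le_multiplicity) (auto simp: sets)
  moreover have "real (card Y) * p \<le> (\<Sum>y\<in>Y. prob (near_event n L y))"
    using sum_bounded_below[of Y p "\<lambda>y. prob (near_event n L y)"] p_le by simp
  ultimately have "real (card Y) * p \<le> sqrt Q" by simp
  have "p \<ge> 0" by (simp add: p_def)
  have "Q \<ge> 0" using R by (simp add: Q_def)
  have "R ^ n * p \<le> (real (card Y) * 18 ^ n) * p"
    using card_Y \<open>p \<ge> 0\<close> by (intro mult_right_mono)
  also have "\<dots> = 18 ^ n * (real (card Y) * p)" by simp
  also have "\<dots> \<le> 18 ^ n * sqrt Q"
    using \<open>real (card Y) * p \<le> sqrt Q\<close> by (intro mult_left_mono) auto
  finally have "(R ^ n * p)\<^sup>2 \<le> (18 ^ n * sqrt Q)\<^sup>2"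
    using R \<open>p \<ge> 0\<close> by (intro power_mono) auto
  also have "\<dots> = (18 ^ n)\<^sup>2 * Q" using \<open>Q \<ge> 0\<close> by (simp add: power_mult_distrib)
  also have "\<dots> \<le> (18 ^ n)\<^sup>2 * ((40 * R) ^ (n - k) * (40 * R) ^ n)"
  proof -
    have le: "10 * (R + 3) \<le> 40 * R" using R by simp
    show ?thesis
      unfolding Q_def using R
      by (intro mult_left_mono mult_mono[OF power_mono[OF le] power_mono[OF le]]) auto
  qed
  also have "\<dots> \<le> (18 ^ n)\<^sup>2 * ((40 ^ n * R ^ (n - k)) * (40 ^ n * R ^ n))"
  proof (intro mult_left_mono mult_mono)
    have "(40::real) ^ (n - k) \<le> 40 ^ n" by (intro power_increasing) auto
    then show "(40 * R) ^ (n - k) \<le> 40 ^ n * R ^ (n - k)"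
      unfolding power_mult_distrib using R by (intro mult_right_mono) auto
    show "(40 * R) ^ n \<le> 40 ^ n * R ^ n" by (simp add: power_mult_distrib)
  qed (use R in auto)
  also have "\<dots> = (720\<^sup>2) ^ n * (R ^ n * R ^ (n - k))"
  proof -
    have "(18 ^ n)\<^sup>2 * (40 ^ n * 40 ^ n) = ((720::real)\<^sup>2) ^ n"
      by (simp add: power2_eq_square power_mult_distrib[symmetric])
    then show ?thesis by (simp add: mult_ac)
  qed
  finally have "(R ^ n * p)\<^sup>2 \<le> (720\<^sup>2) ^ n * (R ^ n * R ^ (n - k))" .
  moreover have "(R ^ n * p)\<^sup>2 = (p\<^sup>2 * R ^ k) * (R ^ n * R ^ (n - k))"
  proof -
    have "R ^ k * R ^ (n - k) = R ^ n" using k by (simp flip: power_add)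
    then show ?thesis by (simp add: power2_eq_square mult_ac)
  qed
  ultimately have "(p\<^sup>2 * R ^ k) * (R ^ n * R ^ (n - k)) \<le> (720\<^sup>2) ^ n * (R ^ n * R ^ (n - k))"
    by simp
  then show ?thesis
    unfolding p_def using R by (subst (asm) mult_le_cancel_right_pos) auto
qed

section \<open>The diameter of a random intersection\<close>

definition large_intersection :: "nat \<Rightarrow> finseq set \<Rightarrow> finseq set \<Rightarrow> real \<Rightarrow> (finseq \<Rightarrow> finseq) set"
  where "large_intersection n K L \<rho> = {U \<in> orth_group n. \<exists>x\<in>K \<inter> U ` L. \<exists>y\<in>K \<inter> U ` L. \<rho> < norm (x - y)}"

lemma diameter_le_iff_not_large_intersection:
  assumes "U \<in> orth_group n" "0 \<le> \<rho>"
  shows "diameter_le (K \<inter> U ` L) \<rho> \<longleftrightarrow> U \<notin> large_intersection n K L \<rho>"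
proof
  assume le: "diameter_le (K \<inter> U ` L) \<rho>"
  show "U \<notin> large_intersection n K L \<rho>"
  proof
    assume "U \<in> large_intersection n K L \<rho>"
    then obtain x y where xy: "x \<in> K \<inter> U ` L" "y \<in> K \<inter> U ` L" "\<rho> < norm (x - y)"
      unfolding large_intersection_def by blast
    have "dist x y \<le> diameter (K \<inter> U ` L)"
      using le by (intro diameter_bounded_bound xy) (simp add: diameter_le_def)
    then show False using le xy(3) by (simp add: diameter_le_def dist_norm)
  qed
next
  assume not_large: "U \<notin> large_intersection n K L \<rho>"
  have small: "norm (x - y) \<le> \<rho>" if "x \<in> K \<inter> U ` L" "y \<in> K \<inter> U ` L" for x y
  proof -
    have "\<not> \<rho> < norm (x - y)"
      using not_large assms(1) that unfolding large_intersection_def by blast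
    then show ?thesis by simp
  qed
  have "bounded (K \<inter> U ` L)"
    unfolding bounded_two_points dist_norm using small by blast
  moreover have "diameter (K \<inter> U ` L) \<le> \<rho>" using small assms(2) by (intro diameter_le) auto
  ultimately show "diameter_le (K \<inter> U ` L) \<rho>" by (simp add: diameter_le_def)
qed

text \<open>
  A pair of points of \<open>K \<inter> U L\<close> at distance greater than \<open>\<rho>\<close> can be contracted slightly, so that both points lie
  in the interior of \<open>K\<close>, and then moved to a countable dense subset of \<open>L\<close>. So the event is a
  countable union of events that are open in \<open>U\<close>, for arbitrary boundaries of \<open>K\<close> and \<open>L\<close>.
\<close>

lemma large_intersection_sets:
  assumes K: "K \<subseteq> Rn n" "convex K" "unit_ball n \<subseteq> K"
    and L: "L \<subseteq> Rn n" "\<And>l s. l \<in> L \<Longrightarrow> 0 \<le> s \<Longrightarrow> s \<le> 1 \<Longrightarrow> s *\<^sub>R l \<in> L" and \<rho>: "0 \<le> \<rho>"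
  shows "large_intersection n K L \<rho> \<in> sets (borel_orth n)"
proof -
  obtain D where D: "countable D" "D \<subseteq> L" "\<And>l e. l \<in> L \<Longrightarrow> 0 < e \<Longrightarrow> \<exists>s\<in>D. norm (l - s) < e"
    using countable_dense_subset[OF L(1)] by blast
  define P where "P = {(s, s'). s \<in> D \<and> s' \<in> D \<and> \<rho> < norm (s - s')}"
  have "P \<subseteq> D \<times> D" by (auto simp: P_def)
  then have count: "countable P" using D(1) by (meson countable_SIGMA countable_subset)
  have "large_intersection n K L \<rho> = (\<Union>(s, s')\<in>P. {U \<in> orth_group n. U s \<in> Rn_interior n K}
      \<inter> {U \<in> orth_group n. U s' \<in> Rn_interior n K})"
  proof (intro equalityI subsetI)
    fix U assume "U \<in> large_intersection n K L \<rho>"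
    then obtain l l' where U: "U \<in> orth_group n" and l: "l \<in> L" "U l \<in> K" and l': "l' \<in> L" "U l' \<in> K"
      and "\<rho> < norm (U l - U l')" by (auto simp: large_intersection_def)
    note lin = orth_groupD(1)[OF U] and isom = orth_groupD(2)[OF U]
    define d where "d = norm (l - l')"
    have "norm (U l - U l') = d" using isom[of "l - l'"] by (simp add: d_def linear_diff[OF lin])
    then have "\<rho> < d" using \<open>\<rho> < norm (U l - U l')\<close> by simp
    then have "0 < d" using \<rho> by simp
    define t where "t = (\<rho> / d + 1) / 2"
    have t: "0 \<le> t" "t < 1" "t * d = (\<rho> + d) / 2"
      using \<open>\<rho> < d\<close> \<open>0 < d\<close> \<rho> by (auto simp: t_def field_simps)
    define \<delta> where "\<delta> = (t * d - \<rho>) / 2"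
    have "\<delta> > 0" using t \<open>\<rho> < d\<close> by (simp add: \<delta>_def)
    have approx: "\<exists>s\<in>D. norm (t *\<^sub>R m - s) < \<delta> \<and> U s \<in> Rn_interior n K" if m: "m \<in> L" "U m \<in> K" for m
    proof -
      have "t *\<^sub>R U m \<in> Rn_interior n K"
        using K t m by (intro scaleR_in_Rn_interior[where \<eta> = 1]) (auto simp: unit_ball_def)
      then obtain e where e: "0 < e" "\<And>y. y \<in> Rn n \<Longrightarrow> norm (y - t *\<^sub>R U m) < e \<Longrightarrow> y \<in> Rn_interior n K"
        by (rule Rn_interior_open) blast
      have "t *\<^sub>R m \<in> L" using L(2)[OF m(1)] t by simp
      then obtain s where s: "s \<in> D" "norm (t *\<^sub>R m - s) < min \<delta> e"
        using D(3)[OF \<open>t *\<^sub>R m \<in> L\<close>, of "min \<delta> e"] \<open>\<delta> > 0\<close> e(1) by (meson min_less_iff_conj)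
      have "norm (U s - t *\<^sub>R U m) = norm (U (t *\<^sub>R m - s))"
        by (simp add: linear_diff[OF lin] linear_cmul[OF lin] norm_minus_commute)
      then have "norm (U s - t *\<^sub>R U m) < e" using s by (simp add: isom)
      moreover have "U s \<in> Rn n" using orth_groupD(3)[OF U] s D(2) L(1) by blast
      ultimately show ?thesis using s e(2) by auto
    qed
    obtain s where s: "s \<in> D" "norm (t *\<^sub>R l - s) < \<delta>" "U s \<in> Rn_interior n K" using approx[OF l] by blast
    obtain s' where s': "s' \<in> D" "norm (t *\<^sub>R l' - s') < \<delta>" "U s' \<in> Rn_interior n K" using approx[OF l'] by blast
    have "t * d = norm ((t *\<^sub>R l - s) + (s - s') + (s' - t *\<^sub>R l'))"
    proof -
      have "(t *\<^sub>R l - s) + (s - s') + (s' - t *\<^sub>R l') = t *\<^sub>R (l - l')" by (simp add: algebra_simps)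
      then show ?thesis using t by (simp add: d_def)
    qed
    also have "\<dots> \<le> norm (t *\<^sub>R l - s) + norm (s - s') + norm (s' - t *\<^sub>R l')"
      by (intro norm_triangle_le add_mono norm_triangle_ineq order_refl)
    also have "\<dots> < norm (s - s') + 2 * \<delta>"
      using s s' by (simp add: norm_minus_commute)
    finally have "t * d < norm (s - s') + 2 * \<delta>" .
    moreover have "2 * \<delta> = t * d - \<rho>" by (simp add: \<delta>_def)
    ultimately have "\<rho> < norm (s - s')" by linarith
    then have "(s, s') \<in> P" using s s' by (simp add: P_def)
    then show "U \<in> (\<Union>(s, s')\<in>P. {U \<in> orth_group n. U s \<in> Rn_interior n K}
      \<inter> {U \<in> orth_group n. U s' \<in> Rn_interior n K})" using U s s' by blast
  next
    fix U assume "U \<in> (\<Union>(s, s')\<in>P. {U \<in> orth_group n. U s \<in> Rn_interior n K}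
      \<inter> {U \<in> orth_group n. U s' \<in> Rn_interior n K})"
    then obtain s s' where U: "U \<in> orth_group n" and s: "s \<in> L" "s' \<in> L" "\<rho> < norm (s - s')"
      "U s \<in> K" "U s' \<in> K"
      using D(2) Rn_interior_subset[of n K] by (auto simp: P_def)
    have "norm (U s - U s') = norm (s - s')"
      using orth_groupD(2)[OF U, of "s - s'"] by (simp add: linear_diff[OF orth_groupD(1)[OF U]])
    moreover have "U s \<in> K \<inter> U ` L" "U s' \<in> K \<inter> U ` L" using s by auto
    ultimately show "U \<in> large_intersection n K L \<rho>"
      unfolding large_intersection_def using U s(3) by (metis (mono_tags, lifting) mem_Collect_eq)
  qed
  also have "\<dots> \<in> sets (borel_orth n)"
    using count D(2) L(1)
    by (intro sets.countable_UN'') (auto simp: P_def intro!: sets.Int image_in_interior_sets)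
  finally show ?thesis .
qed

text \<open>
  One of two points at distance greater than \<open>2 R\<close> has norm greater than \<open>R\<close>, and \<open>K \<inter> U L\<close> is star-shaped
  about the origin, so it meets the sphere of radius \<open>R\<close>.
\<close>

lemma large_intersection_subset_near_events:
  assumes K: "convex K" "0 \<in> K"
    and L: "\<And>l s. l \<in> L \<Longrightarrow> 0 \<le> s \<Longrightarrow> s \<le> 1 \<Longrightarrow> s *\<^sub>R l \<in> L"
    and R: "0 < R" and net: "\<And>z. z \<in> K \<Longrightarrow> norm z = R \<Longrightarrow> \<exists>y\<in>Y. norm (z - y) \<le> 2"
  shows "large_intersection n K L (2 * R) \<subseteq> (\<Union>y\<in>Y. near_event n L y)"
proof
  fix U assume "U \<in> large_intersection n K L (2 * R)"
  then obtain l l' where U: "U \<in> orth_group n" and l: "l \<in> L" "U l \<in> K" and l': "l' \<in> L" "U l' \<in> K"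
    and gt: "2 * R < norm (U l - U l')" by (auto simp: large_intersection_def)
  note lin = orth_groupD(1)[OF U]
  have "R < norm (U l) \<or> R < norm (U l')"
    using norm_triangle_ineq4[of "U l" "U l'"] gt by linarith
  then obtain m where m: "m \<in> L" "U m \<in> K" "R < norm (U m)" using l l' by blast
  define s where "s = R / norm (U m)"
  have "0 < norm (U m)" using m(3) R by linarith
  then have s: "0 \<le> s" "s \<le> 1" "norm (s *\<^sub>R U m) = R"
    using m R by (auto simp: s_def divide_le_eq)
  have "s *\<^sub>R U m + (1 - s) *\<^sub>R 0 \<in> K" using s m K by (intro convexD[OF K(1)]) auto
  then obtain y where y: "y \<in> Y" "norm (s *\<^sub>R U m - y) \<le> 2" using net[of "s *\<^sub>R U m"] s by auto
  have "norm (U (s *\<^sub>R m) - y) < 3" using y by (simp add: linear_cmul[OF lin])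
  then show "U \<in> (\<Union>y\<in>Y. near_event n L y)"
    using U y L[OF m(1) s(1,2)] by (auto simp: near_event_def)
qed

lemma large_intersection_probability:
  assumes haar: "normalized_haar n \<mu>" and k: "1 \<le> k" "k \<le> n"
    and K: "K \<subseteq> Rn n" "convex K" "has_volume_ratio n K A"
    and L: "L \<subseteq> Rn n" "convex L" "\<And>x. x \<in> L \<Longrightarrow> - x \<in> L"
    and E: "subspace E" "E \<subseteq> Rn n" "dim E = k"
    and bdd: "\<And>x. x \<in> L \<Longrightarrow> x \<in> E \<Longrightarrow> norm x \<le> 1 / 2" and R: "1 \<le> R"
  shows "(measure \<mu> (large_intersection n K L (2 * R)))\<^sup>2 * R ^ k \<le> ((2 * A)\<^sup>2) ^ n * (720\<^sup>2) ^ n"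
proof -
  have sets: "sets \<mu> = sets (borel_orth n)" using haar by (auto simp: normalized_haar_def)
  interpret prob_space \<mu> using haar by (simp add: normalized_haar_def)
  have n: "1 \<le> n" using k by simp
  have D: "unit_ball n \<subseteq> K" using K(3) by (simp add: has_volume_ratio_def)
  then have "0 \<in> K" by (auto simp: unit_ball_def)
  have star: "s *\<^sub>R l \<in> L" if "l \<in> L" "0 \<le> s" "s \<le> 1" for l s
    using symmetric_convex_abs_combination[OF L(2,3) that(1) that(1), of s 0] that by simp
  let ?S = "{z \<in> K. norm z = R}"
  have "real (card Y) \<le> (2 * A) ^ n" if "Y \<subseteq> ?S" "separated 2 Y" for Y
    by (rule volume_ratio_packing(2)[OF n K]) (use that in \<open>auto simp: separated_def\<close>)
  note card_le = this
  obtain Y where Y: "Y \<subseteq> ?S" "separated 2 Y" and net: "\<And>z. z \<in> ?S \<Longrightarrow> \<exists>y\<in>Y. norm (z - y) \<le> 2"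
    using maximal_separated_subset[of ?S 2, OF card_le] by auto
  have fin: "finite Y" using Y by (simp add: separated_def)
  define B where "B = (\<lambda>y. measure \<mu> (near_event n L y))"
  define b where "b = sqrt ((720\<^sup>2) ^ n / R ^ k)"
  have b: "B y \<le> b" if "y \<in> Y" for y
  proof -
    have "(B y)\<^sup>2 * R ^ k \<le> (720\<^sup>2) ^ n"
      unfolding B_def using Y that K(1) R
      by (intro near_event_probability[OF haar L E k(2) bdd]) auto
    then have "(B y)\<^sup>2 \<le> (720\<^sup>2) ^ n / R ^ k" using R by (simp add: pos_le_divide_eq)
    then show ?thesis unfolding b_def by (rule real_le_rsqrt)
  qed
  have "measure \<mu> (large_intersection n K L (2 * R)) \<le> measure \<mu> (\<Union>y\<in>Y. near_event n L y)"
  proof (rule finite_measure_mono)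
    show "large_intersection n K L (2 * R) \<subseteq> (\<Union>y\<in>Y. near_event n L y)"
      using net R by (intro large_intersection_subset_near_events[OF K(2) \<open>0 \<in> K\<close> star]) auto
    show "(\<Union>y\<in>Y. near_event n L y) \<in> events"
      using fin Y K(1) near_event_sets[OF L(1)] by (intro sets.finite_UN) (auto simp: sets)
  qed
  also have "\<dots> \<le> (\<Sum>y\<in>Y. B y)"
    unfolding B_def using fin Y K(1) near_event_sets[OF L(1)]
    by (intro finite_measure_subadditive_finite) (auto simp: sets)
  also have "\<dots> \<le> real (card Y) * b"
    using sum_bounded_above[of Y B b] b by simp
  also have "\<dots> \<le> (2 * A) ^ n * b"
    using card_le[OF Y] R by (intro mult_right_mono) (auto simp: b_def)
  finally have "(measure \<mu> (large_intersection n K L (2 * R)))\<^sup>2 \<le> ((2 * A) ^ n * b)\<^sup>2"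
    by (intro power_mono) auto
  also have "\<dots> = ((2 * A)\<^sup>2) ^ n * (720\<^sup>2) ^ n / R ^ k"
  proof -
    have "b\<^sup>2 = (720\<^sup>2) ^ n / R ^ k" using R by (simp add: b_def)
    moreover have "((2 * A) ^ n)\<^sup>2 = ((2 * A)\<^sup>2) ^ n"
      by (simp only: power_mult[symmetric] mult.commute)
    ultimately show ?thesis by (metis power_mult_distrib times_divide_eq_right)
  qed
  finally show ?thesis using R by (simp add: pos_le_divide_eq)
qed

theorem corollary1p3:
  shows "\<exists>C::real. C > 0 \<and>
    (\<forall>(n::nat) (k::nat) (A::real) (K::finseq set) (L::finseq set) \<mu>.
      1 \<le> k \<longrightarrow> k \<le> n \<longrightarrow>
      K \<subseteq> Rn n \<longrightarrow> convex K \<longrightarrow> has_volume_ratio n K A \<longrightarrow>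
      L \<subseteq> Rn n \<longrightarrow> convex L \<longrightarrow> uminus ` L = L \<longrightarrow>
      (\<exists>E. subspace E \<and> E \<subseteq> Rn n \<and> dim E = k \<and> diameter_le (L \<inter> E) 1) \<longrightarrow>
      normalized_haar n \<mu> \<longrightarrow>
      measure \<mu> {U \<in> orth_group n.
          diameter_le (K \<inter> U ` L) ((2 * A) powr (C * real n / real k))}
        \<ge> 1 - exp (- real n))"
proof (intro exI[of _ 27] conjI allI impI)
  show "(0::real) < 27" by simp
next
  fix n k :: nat and A :: real and K L :: "finseq set" and \<mu> :: "(finseq \<Rightarrow> finseq) measure"
  assume k: "1 \<le> k" "k \<le> n"
    and K: "K \<subseteq> Rn n" "convex K" "has_volume_ratio n K A"
    and L: "L \<subseteq> Rn n" "convex L" "uminus ` L = L"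
    and ex: "\<exists>E. subspace E \<and> E \<subseteq> Rn n \<and> dim E = k \<and> diameter_le (L \<inter> E) 1"
    and haar: "normalized_haar n \<mu>"
  have sets: "sets \<mu> = sets (borel_orth n)" using haar by (auto simp: normalized_haar_def)
  interpret prob_space \<mu> using haar by (simp add: normalized_haar_def)
  have space: "space \<mu> = orth_group n"
    using sets_eq_imp_space_eq[OF sets] by (simp add: space_borel_orth)
  have n: "1 \<le> n" using k by simp
  have A: "1 \<le> A" by (rule volume_ratio_packing(1)[OF n K])
  have sym: "- x \<in> L" if "x \<in> L" for x using L(3) that by blast
  obtain E where E: "subspace E" "E \<subseteq> Rn n" "dim E = k" and diam: "diameter_le (L \<inter> E) 1"
    using ex by blast
  have bdd: "norm x \<le> 1 / 2" if x: "x \<in> L" "x \<in> E" for x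
  proof -
    have "- x \<in> L \<inter> E" using sym x E(1) by (simp add: subspace_neg)
    then have "dist x (- x) \<le> diameter (L \<inter> E)"
      using diam x by (intro diameter_bounded_bound) (auto simp: diameter_le_def)
    moreover have "dist x (- x) = 2 * norm x"
      by (simp add: dist_norm scaleR_2[symmetric])
    ultimately show ?thesis using diam by (simp add: diameter_le_def)
  qed
  \<comment> \<open>Of the exponent \<open>27 n/k\<close>, one unit absorbs the factor \<open>2\<close> between diameter and radius. The remaining
     \<open>26\<close> satisfy \<open>(2 A)\<^sup>2 \<cdot> 720\<^sup>2 \<cdot> e\<^sup>2 \<le> (2 A)\<^sup>2\<^sup>6\<close>, because \<open>720 e \<le> 2160 \<le> 2\<^sup>1\<^sup>2\<close> and \<open>2 \<le> 2 A\<close>.\<close>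
  define \<rho> where "\<rho> = (2 * A) powr (27 * real n / real k)"
  define R where "R = \<rho> / 2"
  have "2 * A \<ge> 2" using A by simp
  have R_ge: "(2 * A) powr (26 * real n / real k) \<le> R"
  proof -
    have "1 \<le> real n / real k" using k by simp
    then have "(2 * A) powr 1 \<le> (2 * A) powr (real n / real k)"
      using \<open>2 * A \<ge> 2\<close> by (intro powr_mono) auto
    then have "2 \<le> (2 * A) powr (real n / real k)" using \<open>2 * A \<ge> 2\<close> by simp
    then have "(2 * A) powr (26 * real n / real k) * 2
        \<le> (2 * A) powr (26 * real n / real k) * (2 * A) powr (real n / real k)"
      by (intro mult_left_mono) auto
    also have "\<dots> = \<rho>"
      proof -
      have "26 * real n / real k + real n / real k = 27 * real n / real k" by simp
      then show ?thesis unfolding \<rho>_def powr_add[symmetric] by (simp only:)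
    qed
    finally show ?thesis by (simp add: R_def)
  qed
  have "1 \<le> (2 * A) powr (26 * real n / real k)"
    using \<open>2 * A \<ge> 2\<close> by (intro ge_one_powr_ge_zero) auto
  then have "1 \<le> R" using R_ge by simp
  have R_pow: "((2 * A) ^ 26) ^ n \<le> R ^ k"
  proof -
    have "((2 * A) ^ 26) ^ n = (2 * A) powr (real (26 * n))"
      using \<open>2 * A \<ge> 2\<close> by (simp only: power_mult[symmetric] powr_realpow)
    also have "\<dots> = ((2 * A) powr (26 * real n / real k)) powr real k"
      using k by (simp add: powr_powr)
    also have "\<dots> = ((2 * A) powr (26 * real n / real k)) ^ k"
      using \<open>2 * A \<ge> 2\<close> by (intro powr_realpow) auto
    also have "\<dots> \<le> R ^ k" using R_ge by (intro power_mono) auto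
    finally show ?thesis .
  qed
  define p where "p = measure \<mu> (large_intersection n K L \<rho>)"
  have "\<rho> = 2 * R" by (simp add: R_def)
  have p: "p\<^sup>2 * R ^ k \<le> ((2 * A)\<^sup>2) ^ n * (720\<^sup>2) ^ n"
    unfolding p_def \<open>\<rho> = 2 * R\<close>
    by (rule large_intersection_probability[OF haar k K L(1,2) sym E bdd \<open>1 \<le> R\<close>])
  have "p\<^sup>2 * ((2 * A) ^ 26) ^ n \<le> p\<^sup>2 * R ^ k" by (intro mult_left_mono R_pow) simp
  also note p
  finally have p1: "p\<^sup>2 * ((2 * A) ^ 26) ^ n \<le> ((2 * A)\<^sup>2) ^ n * (720\<^sup>2) ^ n" .
  have "(exp 1 ^ 2 * 720\<^sup>2) ^ n * ((2 * A)\<^sup>2) ^ n \<le> ((2 * A) ^ 24) ^ n * ((2 * A)\<^sup>2) ^ n"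
  proof (intro mult_right_mono power_mono)
    have "exp (1::real) ^ 2 \<le> 3 ^ 2" using exp_le by (intro power_mono) auto
    then have "exp (1::real) ^ 2 * 720\<^sup>2 \<le> 2 ^ 24" by simp
    also have "\<dots> \<le> (2 * A) ^ 24" using \<open>2 * A \<ge> 2\<close> by (intro power_mono) auto
    finally show "exp (1::real) ^ 2 * 720\<^sup>2 \<le> (2 * A) ^ 24" .
  qed auto
  also have "((2 * A) ^ 24) ^ n * ((2 * A)\<^sup>2) ^ n = ((2 * A) ^ 26) ^ n"
  proof -
    have "(2 * A) ^ 24 * (2 * A)\<^sup>2 = (2 * A) ^ 26" by (simp only: power_add[symmetric]) simp
    then show ?thesis by (metis power_mult_distrib)
  qed
  finally have "p\<^sup>2 * ((exp 1 ^ 2 * 720\<^sup>2) ^ n * ((2 * A)\<^sup>2) ^ n) \<le> p\<^sup>2 * ((2 * A) ^ 26) ^ n"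
    by (intro mult_left_mono) auto
  also note p1
  also have "p\<^sup>2 * ((exp 1 ^ 2 * 720\<^sup>2) ^ n * ((2 * A)\<^sup>2) ^ n)
      = (p\<^sup>2 * (exp 1 ^ 2) ^ n) * (((2 * A)\<^sup>2) ^ n * (720\<^sup>2) ^ n)"
    by (simp only: power_mult_distrib mult_ac)
  finally have "(p\<^sup>2 * (exp 1 ^ 2) ^ n) * (((2 * A)\<^sup>2) ^ n * (720\<^sup>2) ^ n) \<le> 1 * (((2 * A)\<^sup>2) ^ n * (720\<^sup>2) ^ n)"
    by simp
  moreover have "0 < ((2 * A)\<^sup>2) ^ n * (720\<^sup>2) ^ n" using A by (intro mult_pos_pos zero_less_power) auto
  ultimately have "p\<^sup>2 * (exp 1 ^ 2) ^ n \<le> 1" by (simp only: mult_le_cancel_right_pos)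
  moreover have "p\<^sup>2 * (exp 1 ^ 2) ^ n = (p * exp (real n))\<^sup>2"
  proof -
    have "exp (real n) = exp 1 ^ n" using exp_of_nat_mult[of n "1::real"] by simp
    moreover have "(exp 1 ^ n)\<^sup>2 = (exp (1::real) ^ 2) ^ n"
      by (simp only: power_mult[symmetric] mult.commute)
    ultimately show ?thesis by (simp only: power_mult_distrib)
  qed
  ultimately have "(p * exp (real n))\<^sup>2 \<le> 1\<^sup>2" by simp
  then have "p * exp (real n) \<le> 1" by (rule power2_le_imp_le) simp
  then have p_le: "p \<le> exp (- real n)" 
    by (simp add: exp_minus inverse_eq_divide pos_le_divide_eq)
  have star: "s *\<^sub>R l \<in> L" if "l \<in> L" "0 \<le> s" "s \<le> 1" for l s
    using symmetric_convex_abs_combination[OF L(2) sym that(1) that(1), of s 0] that by simp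
  have "0 \<le> \<rho>" by (simp add: \<rho>_def)
  have "large_intersection n K L \<rho> \<in> events"
    unfolding sets
    using K(3) by (intro large_intersection_sets[OF K(1,2) _ L(1) star \<open>0 \<le> \<rho>\<close>])
      (auto simp: has_volume_ratio_def)
  then have "prob (space \<mu> - large_intersection n K L \<rho>) = 1 - p"
    by (simp add: prob_compl p_def)
  moreover have "{U \<in> orth_group n. diameter_le (K \<inter> U ` L) \<rho>} = space \<mu> - large_intersection n K L \<rho>"
    using diameter_le_iff_not_large_intersection[OF _ \<open>0 \<le> \<rho>\<close>] by (auto simp: space)
  ultimately show "1 - exp (- real n)
      \<le> measure \<mu> {U \<in> orth_group n. diameter_le (K \<inter> U ` L) ((2 * A) powr (27 * real n / real k))}"
    using p_le by (simp add: \<rho>_def[symmetric])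
qed

end
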